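(* Let $G$ be a finite abelian group, $\mathbf{k}$ a field with $\operatorname{char}\mathbf{k}\nmid|G|$, and $V$ a finite-dimensional, faithful representation of $G$ over $\mathbf{k}$ in which exactly two distinct nontrivial characters of $G$ occur. Then $$\gamma_{\mathrm{field}}(G,V)=\beta_{\mathrm{field}}(G,V).$$
   Context: $\mathbf{k}[V]$ is the ring of polynomial functions on $V$, $\mathbf{k}(V)$ its fraction field, with $G$ acting by $(gf)(v)=f(g^{-1}v)$; $\mathbf{k}[V]^G$, $\mathbf{k}(V)^G$ are the invariants, and $\mathbf{k}[V]^G_{\leq d}$ is the space of invariant polynomials of degree at most $d$. $\beta_{\mathrm{field}}(G,V)$ is the least natural number $d$ such that $\mathbf{k}[V]^G_{\leq d}$ generates $\mathbf{k}(V)^G$ as a field extension of $\mathbf{k}$. $\gamma_{\mathrm{field}}(G,V)$ is the least natural number $d$ such that $\mathbf{k}(V)^G$ is a finite field extension of its subfield $\mathbf{k}(\mathbf{k}[V]^G_{\leq d})$. The characters occurring in $V$ means the characters occurring in $\mathbf{K}\otimes_{\mathbf{k}}V$, where $\mathbf{K}\supseteq\mathbf{k}$ is an extension field containing the $|G|$th roots of unity. *)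

theory Defs
  imports
    "HOL-Analysis.Analysis"
    "HOL-Library.Poly_Mapping"
    "HOL-Algebra.Algebra"
    "HOL-Algebra.Algebraic_Closure_Type"
begin

no_notation fps_nth (infixl \<open>$\<close> 75)

type_synonym ('k, 'n) sqmat = "'k ^ 'n ^ 'n"

definition GL :: "('k::field, 'n::finite) sqmat monoid" where
  "GL = \<lparr>carrier = {A. invertible A}, monoid.mult = (**), one = mat 1\<rparr>"

text \<open>
  A finite-dimensional representation is a homomorphism \<open>\<rho>\<close> from \<open>G\<close> to \<open>GL\<close>, acting on the column
  space \<open>'k ^ 'n\<close>; it is faithful if \<open>\<rho>\<close> is injective.
\<close>

definition faithful_rep :: "('g, 'b) monoid_scheme \<Rightarrow> ('g \<Rightarrow> ('k::field, 'n::finite) sqmat) \<Rightarrow> bool" where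
  "faithful_rep G \<rho> \<longleftrightarrow> \<rho> \<in> hom G GL \<and> inj_on \<rho> (carrier G)"

text \<open>
  The coordinate ring of \<open>'k ^ 'n\<close> is the ring of formal polynomials in indeterminates indexed by
  \<open>'n\<close> (that is, the symmetric algebra of the dual space, also when \<open>'k\<close> is finite). A polynomial
  maps exponent vectors to coefficients. The order on \<open>'n\<close> plays no mathematical role: the
  library needs it to see that this ring is an integral domain.
\<close>

type_synonym ('k, 'n) mpoly = "('n \<Rightarrow>\<^sub>0 nat) \<Rightarrow>\<^sub>0 'k"

definition mconst :: "'k::field \<Rightarrow> ('k, 'n) mpoly" where
  "mconst c = Poly_Mapping.single 0 c"

definition mvar :: "'n \<Rightarrow> ('k::field, 'n) mpoly" where
  "mvar i = Poly_Mapping.single (Poly_Mapping.single i 1) 1"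

definition total_degree :: "('k::field, 'n::finite) mpoly \<Rightarrow> nat" where
  "total_degree f =
    Max (insert 0 ((\<lambda>m. \<Sum>i\<in>UNIV. Poly_Mapping.lookup m i) ` Poly_Mapping.keys f))"

definition msubst :: "('n::finite \<Rightarrow> ('k::field, 'n) mpoly) \<Rightarrow> ('k, 'n) mpoly \<Rightarrow> ('k, 'n) mpoly" where
  "msubst s f = (\<Sum>m\<in>Poly_Mapping.keys f.
     mconst (Poly_Mapping.lookup f m) * (\<Prod>i\<in>UNIV. s i ^ Poly_Mapping.lookup m i))"

text \<open>The polynomial function \<open>v \<mapsto> f (A v)\<close>.\<close>

definition lin_subst :: "('k::field, 'n::finite) sqmat \<Rightarrow> ('k, 'n) mpoly \<Rightarrow> ('k, 'n) mpoly" where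
  "lin_subst A = msubst (\<lambda>i. \<Sum>j\<in>UNIV. mconst (A $ i $ j) * mvar j)"

text \<open>
  The induced map \<open>a / b \<mapsto> (a \<circ> A) / (b \<circ> A)\<close> on fractions, for invertible \<open>A\<close>; by
  \<open>rat_lin_subst_Fract\<close> below it does not depend on how the fraction is written.
\<close>

definition rat_lin_subst ::
  "('k::field, 'n::{finite,linorder}) sqmat \<Rightarrow> ('k, 'n) mpoly fract \<Rightarrow> ('k, 'n) mpoly fract" where
  "rat_lin_subst A q =
    (THE r. \<exists>a b. b \<noteq> 0 \<and> q = Fract a b \<and> r = Fract (lin_subst A a) (lin_subst A b))"

lemma mconst_mult: "mconst (x * y) = mconst x * mconst y"
  by (simp add: mconst_def mult_single)

lemma mconst_sum: "mconst (sum h A) = (\<Sum>x\<in>A. mconst (h x))"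
  by (induction A rule: infinite_finite_induct) (auto simp: mconst_def single_add)

lemma msubst_superset:
  assumes "finite S" "Poly_Mapping.keys f \<subseteq> S"
  shows "msubst s f = (\<Sum>m\<in>S.
     mconst (Poly_Mapping.lookup f m) * (\<Prod>i\<in>UNIV. s i ^ Poly_Mapping.lookup m i))"
  unfolding msubst_def
  by (rule sum.mono_neutral_left) (use assms in \<open>auto simp: mconst_def in_keys_iff\<close>)

lemma msubst_zero [simp]: "msubst s 0 = 0"
  by (simp add: msubst_def)

lemma msubst_add: "msubst s (f + g) = msubst s f + msubst s g"
proof -
  let ?S = "Poly_Mapping.keys f \<union> Poly_Mapping.keys g"
  have "Poly_Mapping.keys (f + g) \<subseteq> ?S"
    by (rule Poly_Mapping.keys_add)
  then show ?thesis
    by (subst (1 2 3) msubst_superset[of ?S])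
       (auto simp: mconst_def lookup_add single_add distrib_right sum.distrib)
qed

lemma msubst_sum: "msubst s (sum f A) = (\<Sum>x\<in>A. msubst s (f x))"
  by (induction A rule: infinite_finite_induct) (auto simp: msubst_add)

lemma msubst_single:
  "msubst s (Poly_Mapping.single m c) = mconst c * (\<Prod>i\<in>UNIV. s i ^ Poly_Mapping.lookup m i)"
  by (subst msubst_superset[of "{m}"]) auto

lemma mpoly_decomp:
  fixes f :: "('k::field, 'n) mpoly"
  shows "f = (\<Sum>m\<in>Poly_Mapping.keys f. Poly_Mapping.single m (Poly_Mapping.lookup f m))"
  by (rule poly_mapping_eqI)
     (simp add: lookup_sum lookup_single when_def sum.delta' in_keys_iff)

lemma msubst_mult: "msubst s (f * g) = msubst s f * msubst s g"
proof -
  let ?F = "\<lambda>f m. Poly_Mapping.single m (Poly_Mapping.lookup f m)"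
  have single: "msubst s (?F f m * ?F g m') = msubst s (?F f m) * msubst s (?F g m')" for m m'
    by (simp add: mult_single msubst_single lookup_add power_add prod.distrib mconst_mult mult_ac)
  have f: "msubst s f = (\<Sum>m\<in>Poly_Mapping.keys f. msubst s (?F f m))" for f
    by (subst (1) mpoly_decomp) (rule msubst_sum)
  have "f * g = (\<Sum>m\<in>Poly_Mapping.keys f. ?F f m) * (\<Sum>m\<in>Poly_Mapping.keys g. ?F g m)"
    using mpoly_decomp[of f] mpoly_decomp[of g] by metis
  then show ?thesis
    by (simp add: sum_product msubst_sum single f[of f] f[of g])
qed

lemma msubst_mconst [simp]: "msubst s (mconst c) = mconst c"
  by (simp add: mconst_def msubst_single)

lemma msubst_one [simp]: "msubst s 1 = 1"
  using msubst_mconst[of s 1] by (simp add: mconst_def)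

lemma msubst_mvar [simp]: "msubst s (mvar i) = s i"
proof -
  have "(\<Prod>j\<in>UNIV. s j ^ Poly_Mapping.lookup (Poly_Mapping.single i 1) j) = s i"
    by (subst prod.remove[of _ i]) (auto simp: lookup_single_not_eq)
  then show ?thesis
    by (simp add: mvar_def msubst_single mconst_def)
qed

lemma msubst_power: "msubst s (f ^ k) = msubst s f ^ k"
  by (induction k) (auto simp: msubst_mult)

lemma msubst_prod: "msubst s (prod f A) = (\<Prod>x\<in>A. msubst s (f x))"
  by (induction A rule: infinite_finite_induct) (auto simp: msubst_mult)

lemma msubst_msubst: "msubst t (msubst s f) = msubst (\<lambda>i. msubst t (s i)) f"
  unfolding msubst_def[of s f] msubst_def[of "\<lambda>i. msubst t (s i)" f]
  by (simp add: msubst_sum msubst_mult msubst_prod msubst_power)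

lemma mvar_power: "mvar i ^ k = Poly_Mapping.single (Poly_Mapping.single i k) 1"
  by (induction k) (auto simp: mvar_def mult_single simp flip: single_add)

lemma prod_mvar: "(\<Prod>i\<in>A. mvar i ^ e i) =
    Poly_Mapping.single (\<Sum>i\<in>A. Poly_Mapping.single i (e i)) (1::'k::field)"
  by (induction A rule: infinite_finite_induct) (auto simp: mvar_power mult_single)

lemma msubst_id:
  fixes f :: "('k::field, 'n::finite) mpoly"
  shows "msubst mvar f = f"
proof -
  have m: "(\<Sum>i\<in>UNIV. Poly_Mapping.single i (Poly_Mapping.lookup m i)) = m"
    for m :: "'n \<Rightarrow>\<^sub>0 nat"
    by (rule poly_mapping_eqI) (simp add: lookup_sum lookup_single when_def sum.delta')
  have "msubst mvar f =
      (\<Sum>m\<in>Poly_Mapping.keys f. Poly_Mapping.single m (Poly_Mapping.lookup f m))"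
    unfolding msubst_def prod_mvar m by (simp add: mconst_def mult_single)
  also have "\<dots> = f"
    by (rule mpoly_decomp[symmetric])
  finally show ?thesis .
qed

lemma lin_subst_lin_subst: "lin_subst B (lin_subst A f) = lin_subst (A ** B) f"
proof -
  have "msubst (\<lambda>i. \<Sum>j\<in>UNIV. mconst (B $ i $ j) * mvar j) (\<Sum>j\<in>UNIV. mconst (A $ i $ j) * mvar j)
      = (\<Sum>j\<in>UNIV. mconst ((A ** B) $ i $ j) * mvar j)" for i
    by (simp add: msubst_sum msubst_mult matrix_matrix_mult_def mconst_sum mconst_mult sum_distrib_left
          sum_distrib_right mult.assoc) (rule sum.swap)
  then show ?thesis
    by (simp add: lin_subst_def msubst_msubst)
qed

lemma lin_subst_id [simp]:
  fixes f :: "('k::field, 'n::finite) mpoly"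
  shows "lin_subst (mat 1) f = f"
proof -
  have "(\<Sum>j\<in>UNIV. mconst ((mat 1 :: ('k, 'n) sqmat) $ i $ j) * mvar j) = mvar i" for i
    by (subst sum.remove[of _ i]) (auto simp: mat_def mconst_def intro!: sum.neutral)
  then show ?thesis
    by (simp add: lin_subst_def msubst_id)
qed

lemma lin_subst_zero [simp]: "lin_subst A 0 = 0"
  by (simp add: lin_subst_def)

lemma lin_subst_mult: "lin_subst A (f * g) = lin_subst A f * lin_subst A g"
  by (simp add: lin_subst_def msubst_mult)

lemma lin_subst_eq_0_iff:
  assumes "invertible A"
  shows "lin_subst A f = 0 \<longleftrightarrow> f = 0"
proof
  obtain B where B: "A ** B = mat 1"
    using assms by (auto simp: invertible_def)
  assume "lin_subst A f = 0"
  then show "f = 0"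
    using lin_subst_lin_subst[of B A f] by (simp add: B)
qed simp

lemma rat_lin_subst_Fract:
  assumes "invertible A" "b \<noteq> 0"
  shows "rat_lin_subst A (Fract a b) = Fract (lin_subst A a) (lin_subst A b)"
  unfolding rat_lin_subst_def
proof (rule the_equality)
  fix r
  assume "\<exists>a' b'. b' \<noteq> 0 \<and> Fract a b = Fract a' b' \<and> r = Fract (lin_subst A a') (lin_subst A b')"
  then obtain a' b' where *: "b' \<noteq> 0" "Fract a b = Fract a' b'"
    and r: "r = Fract (lin_subst A a') (lin_subst A b')"
    by blast
  then have "a * b' = a' * b"
    using assms(2) by (simp add: eq_fract)
  then have "lin_subst A a * lin_subst A b' = lin_subst A a' * lin_subst A b"
    by (simp flip: lin_subst_mult)
  then show "r = Fract (lin_subst A a) (lin_subst A b)"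
    using assms * by (simp add: r eq_fract lin_subst_eq_0_iff)
qed (use assms in blast)

definition poly_invariants_le ::
  "('g, 'b) monoid_scheme \<Rightarrow> ('g \<Rightarrow> ('k::field, 'n::finite) sqmat) \<Rightarrow> nat \<Rightarrow> ('k, 'n) mpoly set" where
  "poly_invariants_le G \<rho> d =
    {f. (\<forall>g\<in>carrier G. lin_subst (\<rho> (inv\<^bsub>G\<^esub> g)) f = f) \<and> total_degree f \<le> d}"

definition rat_invariants ::
  "('g, 'b) monoid_scheme \<Rightarrow> ('g \<Rightarrow> ('k::field, 'n::{finite,linorder}) sqmat) \<Rightarrow> ('k, 'n) mpoly fract set" where
  "rat_invariants G \<rho> = {q. \<forall>g\<in>carrier G. rat_lin_subst (\<rho> (inv\<^bsub>G\<^esub> g)) q = q}"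

definition adjoin :: "('k::field, 'n::{finite,linorder}) mpoly set \<Rightarrow> ('k, 'n) mpoly fract set" where
  "adjoin S = generate_field ring_of_type_algebra (to_fract ` (range mconst \<union> S))"

definition beta_field ::
  "('g, 'b) monoid_scheme \<Rightarrow> ('g \<Rightarrow> ('k::field, 'n::{finite,linorder}) sqmat) \<Rightarrow> nat" where
  "beta_field G \<rho> = (LEAST d. adjoin (poly_invariants_le G \<rho> d) = rat_invariants G \<rho>)"

definition gamma_field ::
  "('g, 'b) monoid_scheme \<Rightarrow> ('g \<Rightarrow> ('k::field, 'n::{finite,linorder}) sqmat) \<Rightarrow> nat" where
  "gamma_field G \<rho> = (LEAST d.
     ring.finite_dimension ring_of_type_algebra (adjoin (poly_invariants_le G \<rho> d)) (rat_invariants G \<rho>))"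

text \<open>
  The characters occurring in \<open>K \<otimes> V\<close>, where \<open>K\<close> is the field given by the type \<open>'e\<close>, viewed as
  an extension of \<open>'k\<close> through the embedding \<open>\<phi>\<close>. Characters are taken to be extensional, so that
  distinct ones differ on \<open>carrier G\<close>.
\<close>

definition occurring_characters ::
  "('g, 'b) monoid_scheme \<Rightarrow> ('k::field \<Rightarrow> 'e::field) \<Rightarrow> ('g \<Rightarrow> ('k, 'n::finite) sqmat) \<Rightarrow> ('g \<Rightarrow> 'e) set" where
  "occurring_characters G \<phi> \<rho> =
    {c \<in> hom G (units_of ring_of_type_algebra) \<inter> extensional (carrier G).
      \<exists>v :: 'e ^ 'n. v \<noteq> 0 \<and>
        (\<forall>g\<in>carrier G. (\<chi> i j. \<phi> (\<rho> g $ i $ j)) *v v = c g *s v)}"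

end

theory Submission
  imports Defs
begin

text \<open>
  For every \<open>d\<close>, the extension of \<open>k(k[V]\<^sup>G\<^sub>\<le>\<^sub>d)\<close> to \<open>k(V)\<^sup>G\<close> is finite only if it is trivial. Over \<open>K\<close>
  the representation is diagonal, and a monomial of degree \<open>p\<close> in the coordinates of the first
  character and \<open>q\<close> in those of the second is invariant iff \<open>(p, q)\<close> lies in the lattice
  \<open>L\<close> of relations \<open>\<chi>\<^sub>1\<^sup>p \<chi>\<^sub>2\<^sup>q = 1\<close>. Suppose that the points \<open>p, q \<ge> 0\<close>, \<open>p + q \<le> d\<close> of \<open>L\<close> span the
  plane. Among pairs of them, one with minimal nonzero determinant spans a triangle with the origin
  that contains no further point of \<open>L\<close>, so it is a basis of \<open>L\<close>, and all invariant monomials are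
  quotients of products of those of degree at most \<open>d\<close>. Otherwise these points lie on a line, and
  some grading of \<open>K[V]\<close> gives weight zero to all invariants of degree at most \<open>d\<close> but not to all
  invariants; an element that is not of weight zero is transcendental over those of weight zero.
  Coordinates with respect to a basis of \<open>K\<close> over \<open>k\<close> carry both arguments down to \<open>k\<close>.
\<close>

section \<open>Lattices and exponent vectors\<close>

text \<open>Among the pairs in \<open>C\<close> one of minimal positive determinant \<open>e\<close>
  is taken. Cramer's rule writes any lattice point in terms of it with denominator \<open>e\<close>.
  Subtracting integer parts leaves a point of the half-open parallelogram; unless this is the
  origin, it or its reflection in the centre of the parallelogram yields a pair in \<open>C\<close>
  of smaller positive determinant.\<close>

lemma lattice_basis_bounded_degree:
  fixes L :: "int \<Rightarrow> int \<Rightarrow> bool" and d :: int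
  defines "C \<equiv> \<lambda>p q. L p q \<and> 0 \<le> p \<and> 0 \<le> q \<and> p + q \<le> d"
  assumes diff: "\<And>p q r s. L p q \<Longrightarrow> L r s \<Longrightarrow> L (p - r) (q - s)"
    and ex: "C p0 q0" "C r0 s0" "p0 * s0 \<noteq> q0 * r0"
  shows "\<exists>p q r s. C p q \<and> C r s \<and> (\<forall>x y. L x y \<longrightarrow> (\<exists>a b. x = a * p + b * r \<and> y = a * q + b * s))"
proof -
  have zero: "L 0 0"
    using diff[of p0 q0 p0 q0] ex(1) by (simp add: C_def)
  have neg: "L (- p) (- q)" if "L p q" for p q
    using diff[OF zero that] by simp
  have add: "L (p + r) (q + s)" if "L p q" "L r s" for p q r s
    using diff[OF that(1) neg[OF that(2)]] by simp
  have nmul: "L (int n * p) (int n * q)" if "L p q" for n p q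
  proof (induction n)
    case (Suc n)
    then show ?case
      using add[OF that Suc] by (simp add: algebra_simps)
  qed (simp add: zero)
  have mul: "L (n * p) (n * q)" if "L p q" for n p q
  proof (cases "n \<ge> 0")
    case True
    then show ?thesis using nmul[OF that, of "nat n"] by simp
  next
    case False
    then show ?thesis using neg[OF nmul[OF that, of "nat (- n)"]] by simp
  qed
  define D where "D = (\<lambda>(p, q, r, s). nat (p * s - q * r))"
  define Q where "Q = (\<lambda>(p, q, r, s). C p q \<and> C r s \<and> p * s - q * r > (0::int))"
  have "\<exists>x. Q x"
  proof (cases "p0 * s0 > q0 * r0")
    case True
    then show ?thesis using ex by (intro exI[of _ "(p0, q0, r0, s0)"]) (auto simp: Q_def)
  next
    case False
    then show ?thesis using ex
      by (intro exI[of _ "(r0, s0, p0, q0)"]) (auto simp: Q_def mult.commute)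
  qed
  then obtain z where z: "Q z" "\<And>y. Q y \<Longrightarrow> D z \<le> D y"
    using ex_has_least_nat[of Q _ D] by blast
  obtain p q r s where zeq: "z = (p, q, r, s)"
    by (cases z)
  define e where "e = p * s - q * r"
  have e: "e > 0" and C1: "C p q" and C2: "C r s"
    using z(1) by (auto simp: zeq Q_def e_def)
  have min: "e \<le> p' * s' - q' * r'" if "C p' q'" "C r' s'" "p' * s' - q' * r' > 0" for p' q' r' s'
    using z(2)[of "(p', q', r', s')"] that e by (auto simp: zeq Q_def D_def e_def)
  have nonneg: "0 \<le> x" if "e * x = a * y + b * z" "0 \<le> a" "0 \<le> b" "0 \<le> y" "0 \<le> z" for x y z a b
  proof -
    have "0 \<le> e * x" using that by simp
    then show ?thesis using e by (simp add: zero_le_mult_iff)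
  qed
  \<comment> \<open>The triangle with vertices 0, \<open>(p, q)\<close> and \<open>(r, s)\<close> is
    convex, so its lattice points inherit nonnegativity and the degree bound; at the vertex 0 that
    bound says that \<open>d\<close> is nonnegative.\<close>
  have small: "C x y" if L: "L x y" and x: "e * x = a * p + b * r" and y: "e * y = a * q + b * s"
    and ab: "0 \<le> a" "0 \<le> b" "a + b \<le> e" for x y a b
  proof -
    have "0 \<le> x" "0 \<le> y"
      using nonneg[OF x] nonneg[OF y] ab C1 C2 by (auto simp: C_def)
    have "e * (x + y) = a * (p + q) + b * (r + s)"
      using x y by (simp add: algebra_simps)
    also have "\<dots> \<le> a * d + b * d"
      using C1 C2 ab by (intro add_mono mult_left_mono) (auto simp: C_def)
    also have "\<dots> = (a + b) * d" by (simp add: algebra_simps)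
    also have "\<dots> \<le> e * d"
      using C1 ab by (intro mult_right_mono) (auto simp: C_def)
    finally have "x + y \<le> d" using e by simp
    with \<open>0 \<le> x\<close> \<open>0 \<le> y\<close> show ?thesis using L by (simp add: C_def)
  qed
  have gen: "\<exists>a b. x = a * p + b * r \<and> y = a * q + b * s" if L: "L x y" for x y
  proof -
    \<comment> \<open>Cramer numerators: \<open>e\<close> times \<open>(x, y)\<close> is
      \<open>a\<close> times \<open>(p, q)\<close> plus \<open>b\<close> times
      \<open>(r, s)\<close>. Taking off the integer parts leaves the remainders \<open>a'\<close>
      and \<open>b'\<close> as numerators.\<close>
    define a where "a = x * s - y * r"
    define b where "b = p * y - q * x"
    define x' where "x' = x - ((a div e) * p + (b div e) * r)"
    define y' where "y' = y - ((a div e) * q + (b div e) * s)"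
    define a' where "a' = a mod e"
    define b' where "b' = b mod e"
    have L': "L x' y'"
      unfolding x'_def y'_def using C1 C2 by (intro diff add mul L) (auto simp: C_def)
    have bounds: "0 \<le> a'" "a' < e" "0 \<le> b'" "b' < e"
      using e by (auto simp: a'_def b'_def)
    have "e * x = a * p + b * r" "e * y = a * q + b * s"
      by (simp_all add: e_def a_def b_def algebra_simps)
    then have ex: "e * x' = a' * p + b' * r" and ey: "e * y' = a' * q + b' * s"
      by (simp_all add: x'_def y'_def a'_def b'_def minus_div_mult_eq_mod[symmetric] algebra_simps)
    \<comment> \<open>Replacing the first or the second basis vector by \<open>(x', y')\<close>
      gives determinant \<open>a'\<close> or \<open>b'\<close>; minimality of \<open>e\<close> is
      applied to these.\<close>
    have det1: "x' * s - y' * r = a'"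
    proof -
      have "e * (x' * s - y' * r) = (e * x') * s - (e * y') * r" by (simp add: algebra_simps)
      also have "\<dots> = e * a'" unfolding ex ey by (simp add: e_def algebra_simps)
      finally show ?thesis using e by simp
    qed
    have det2: "p * y' - q * x' = b'"
    proof -
      have "e * (p * y' - q * x') = p * (e * y') - q * (e * x')" by (simp add: algebra_simps)
      also have "\<dots> = e * b'" unfolding ex ey by (simp add: e_def algebra_simps)
      finally show ?thesis using e by simp
    qed
    have "a' = 0 \<and> b' = 0"
    proof (cases "a' + b' \<le> e")
      case True
      then have C: "C x' y'"
        using small[OF L' ex ey] bounds by blast
      show ?thesis
        using min[OF C C2] min[OF C1 C] det1 det2 bounds by linarith
    next
      case False
      \<comment> \<open>The remainder lies beyond the diagonal, so its reflection in the centre of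
        the parallelogram lies in the triangle. Minimality then gives \<open>a' = 0\<close>, whence
        \<open>b' > e\<close>, which is impossible.\<close>
      have "C (p + r - x') (q + s - y')"
      proof (rule small[of _ _ "e - a'" "e - b'"])
        show "L (p + r - x') (q + s - y')"
          using C1 C2 L' by (intro diff add) (auto simp: C_def)
      qed (use ex ey bounds False in \<open>auto simp: algebra_simps\<close>)
      moreover have "(p + r - x') * s - (q + s - y') * r = e - a'"
        using det1 by (simp add: e_def algebra_simps)
      ultimately show ?thesis
        using min[OF _ C2] bounds False by force
    qed
    then have "e * x' = 0" "e * y' = 0"
      using ex ey by auto
    then show ?thesis
      using e by (intro exI[of _ "a div e"] exI[of _ "b div e"]) (auto simp: x'_def y'_def)
  qed
  show ?thesis
    using C1 C2 gen by blast
qed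

section \<open>Bidegrees of exponent vectors\<close>

lemma sum_if_disjoint:
  fixes f g :: "'n::finite \<Rightarrow> 'a::comm_monoid_add"
  assumes "I \<inter> J = {}"
  shows "(\<Sum>i\<in>UNIV. if i \<in> I then f i else if i \<in> J then g i else 0) = sum f I + sum g J"
proof -
  have "(\<Sum>i\<in>UNIV. if i \<in> I then f i else if i \<in> J then g i else 0) =
      (\<Sum>i\<in>UNIV. (if i \<in> I then f i else 0) + (if i \<in> J then g i else 0))"
    using assms by (intro sum.cong) auto
  then show ?thesis
    by (simp add: sum.distrib sum.If_cases)
qed

lemma prod_if_disjoint:
  fixes f g :: "'n::finite \<Rightarrow> 'a::comm_monoid_mult"
  assumes "I \<inter> J = {}"
  shows "(\<Prod>i\<in>UNIV. if i \<in> I then f i else if i \<in> J then g i else 1) = prod f I * prod g J"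
proof -
  have "(\<Prod>i\<in>UNIV. if i \<in> I then f i else if i \<in> J then g i else 1) =
      (\<Prod>i\<in>UNIV. (if i \<in> I then f i else 1) * (if i \<in> J then g i else 1))"
    using assms by (intro prod.cong) auto
  then show ?thesis
    by (simp add: prod.distrib prod.If_cases)
qed

definition deg_on :: "'n set \<Rightarrow> ('n \<Rightarrow>\<^sub>0 nat) \<Rightarrow> nat" where
  "deg_on I m = (\<Sum>i\<in>I. Poly_Mapping.lookup m i)"

lemma deg_on_add: "deg_on I (m + n) = deg_on I m + deg_on I n"
  by (simp add: deg_on_def lookup_add sum.distrib)

lemma deg_on_single:
  fixes i :: "'n::finite"
  shows "deg_on I (Poly_Mapping.single i k) = (if i \<in> I then k else 0)"
  by (simp add: deg_on_def lookup_single when_def sum.delta)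

text \<open>Transfers the lattice basis from bidegrees to exponent vectors in many variables.
  \<open>S\<close> will consist of the exponents of monomials obtained as quotients, whence closure
  under sums and cancellation. Vectors supported on \<open>i0\<close> and \<open>j0\<close> follow
  the lattice; corrections link every other vector to the one of the same bidegree.\<close>

lemma saturated_exponents:
  fixes S :: "('n::finite \<Rightarrow>\<^sub>0 nat) set" and L :: "int \<Rightarrow> int \<Rightarrow> bool"
  assumes disj: "I \<inter> J = {}" and ij: "i0 \<in> I" "j0 \<in> J"
    and L_diff: "\<And>p q r s. L p q \<Longrightarrow> L r s \<Longrightarrow> L (p - r) (q - s)"
    and S_add: "\<And>m n. m \<in> S \<Longrightarrow> n \<in> S \<Longrightarrow> m + n \<in> S"
    and S_cancel: "\<And>m n. m + n \<in> S \<Longrightarrow> n \<in> S \<Longrightarrow> m \<in> S"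
    and gen: "\<And>m. L (int (deg_on I m)) (int (deg_on J m)) \<Longrightarrow> deg_on UNIV m \<le> d \<Longrightarrow> m \<in> S"
    and rank: "L p0 q0" "0 \<le> p0" "0 \<le> q0" "p0 + q0 \<le> int d"
      "L r0 s0" "0 \<le> r0" "0 \<le> s0" "r0 + s0 \<le> int d" "p0 * s0 \<noteq> q0 * r0"
    and m: "L (int (deg_on I m)) (int (deg_on J m))"
  shows "m \<in> S"
proof -
  define u where "u = (\<lambda>p q. Poly_Mapping.single i0 p + Poly_Mapping.single j0 q :: 'n \<Rightarrow>\<^sub>0 nat)"
  have ij': "i0 \<notin> J" "j0 \<notin> I" using disj ij by auto
  have L0: "L 0 0" using L_diff[OF rank(1) rank(1)] by simp
  have S0: "0 \<in> S" by (rule gen) (use L0 in \<open>auto simp: deg_on_def\<close>)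
  have S_sum_nat: "sum f A \<in> S" if "\<And>x. x \<in> A \<Longrightarrow> f x \<in> S" for A :: "nat set" and f
    using that by (induction A rule: infinite_finite_induct) (auto intro: S0 S_add)
  have S_sum: "sum f A \<in> S" if "\<And>x. x \<in> A \<Longrightarrow> f x \<in> S" for A :: "'n set" and f
    using that by (induction A rule: infinite_finite_induct) (auto intro: S0 S_add)
  have deg_u: "deg_on I (u p q) = p" "deg_on J (u p q) = q" "deg_on UNIV (u p q) = p + q" for p q
    using ij ij' by (auto simp: u_def deg_on_add deg_on_single)
  have u_add: "u p q + u r s = u (p + r) (q + s)" for p q r s
    by (simp add: u_def single_add add_ac)
  have u_gen: "u p q \<in> S" if "L (int p) (int q)" "p + q \<le> d" for p q
    by (rule gen) (use that in \<open>auto simp: deg_u\<close>)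

  \<comment> \<open>Two linearly independent points cannot both have first coordinate zero, nor both
    second coordinate zero. Positivity of \<open>p1\<close> and \<open>q2\<close> makes the natural
    subtractions in \<open>r1\<close> and \<open>r2\<close> exact.\<close>
  obtain p1 q1 where 1: "L p1 q1" "0 < p1" "0 \<le> q1" "p1 + q1 \<le> int d"
    using rank by (cases "p0 > 0") (force simp: not_less)+
  obtain p2 q2 where 2: "L p2 q2" "0 \<le> p2" "0 < q2" "p2 + q2 \<le> int d"
    using rank by (cases "q0 > 0") (force simp: not_less)+
  \<comment> \<open>A correction \<open>r i\<close> with \<open>e\<^sub>i + r i \<in> S\<close> that depends only on the class of \<open>i\<close> shows that
    membership in \<open>S\<close> depends only on the bidegree.\<close>
  define r1 where "r1 = u (nat p1 - 1) (nat q1)"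
  define r2 where "r2 = u (nat p2) (nat q2 - 1)"
  define r where "r = (\<lambda>i. if i \<in> I then r1 else if i \<in> J then r2 else 0)"
  have r: "Poly_Mapping.single i 1 + r i \<in> S" for i
  proof (rule gen)
    have "int (nat p1 - 1) = p1 - 1" "int (nat q2 - 1) = q2 - 1"
      using 1 2 by auto
    then show "L (int (deg_on I (Poly_Mapping.single i 1 + r i))) (int (deg_on J (Poly_Mapping.single i 1 + r i)))"
      using 1 2 disj L0 by (auto simp: r_def r1_def r2_def deg_on_add deg_on_single deg_u deg_on_def[of _ 0])
    \<comment> \<open>Outside \<open>I\<close> and \<open>J\<close> there is no correction and the
      degree is 1; \<open>d\<close> is at least 1 because \<open>p1\<close> is positive.\<close>
    show "deg_on UNIV (Poly_Mapping.single i 1 + r i) \<le> d"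
      using 1 2 by (auto simp: r_def r1_def r2_def deg_on_add deg_on_single deg_u deg_on_def[of _ 0])
  qed
  \<comment> \<open>The total correction of a vector of bidegree \<open>(p, q)\<close>, the same for
    all vectors of that bidegree.\<close>
  define W where "W = (\<lambda>(p::nat) (q::nat). (\<Sum>k<p. r1) + (\<Sum>k<q. r2))"
  have W: "n + W (deg_on I n) (deg_on J n) \<in> S" for n
  proof -
    have "(\<Sum>i\<in>UNIV. \<Sum>k<Poly_Mapping.lookup n i. Poly_Mapping.single i 1 + r i) \<in> S"
      by (intro S_sum_nat S_sum r)
    also have "(\<Sum>i\<in>UNIV. \<Sum>k<Poly_Mapping.lookup n i. Poly_Mapping.single i 1 + r i) =
      n + W (deg_on I n) (deg_on J n)"
    proof (rule poly_mapping_eqI)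
      fix x
      have "(\<Sum>i\<in>UNIV. Poly_Mapping.lookup n i * Poly_Mapping.lookup (r i) x) =
        (\<Sum>i\<in>UNIV. if i \<in> I then Poly_Mapping.lookup n i * Poly_Mapping.lookup r1 x
          else if i \<in> J then Poly_Mapping.lookup n i * Poly_Mapping.lookup r2 x else 0)"
        by (intro sum.cong) (auto simp: r_def)
      also have "\<dots> = deg_on I n * Poly_Mapping.lookup r1 x + deg_on J n * Poly_Mapping.lookup r2 x"
        by (subst sum_if_disjoint[OF disj]) (simp add: deg_on_def sum_distrib_right)
      finally have eq: "(\<Sum>i\<in>UNIV. Poly_Mapping.lookup n i * Poly_Mapping.lookup (r i) x) = \<dots>" .
      have "(\<Sum>i\<in>UNIV. Poly_Mapping.lookup n i * (if i = x then Suc 0 else 0)) = Poly_Mapping.lookup n x"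
        by (simp add: if_distrib cong: if_cong)
      then show "Poly_Mapping.lookup (\<Sum>i\<in>UNIV. \<Sum>k<Poly_Mapping.lookup n i. Poly_Mapping.single i 1 + r i) x =
        Poly_Mapping.lookup (n + W (deg_on I n) (deg_on J n)) x"
        by (simp add: lookup_sum lookup_add lookup_single when_def distrib_left sum.distrib eq W_def
            del: mult_Suc_right)
    qed
    finally show ?thesis .
  qed

  obtain p q r s where pq: "L p q \<and> 0 \<le> p \<and> 0 \<le> q \<and> p + q \<le> int d" and rs: "L r s \<and> 0 \<le> r \<and> 0 \<le> s \<and> r + s \<le> int d"
    and basis: "\<And>x y. L x y \<Longrightarrow> \<exists>a b. x = a * p + b * r \<and> y = a * q + b * s"
    using lattice_basis_bounded_degree[where L = L and d = "int d" and ?p0.0 = p0 and ?q0.0 = q0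
        and ?r0.0 = r0 and ?s0.0 = s0] L_diff rank by blast
  obtain a b where ab: "int (deg_on I m) = a * p + b * r" "int (deg_on J m) = a * q + b * s"
    using basis[OF m] by blast
  have u_mult: "u (k * nat x) (k * nat y) \<in> S" if "L x y" "0 \<le> x" "0 \<le> y" "x + y \<le> int d" for k x y
  proof (induction k)
    case 0
    then show ?case using S0 by (simp add: u_def)
  next
    case (Suc k)
    have "u (nat x) (nat y) \<in> S"
      by (rule u_gen) (use that in auto)
    from S_add[OF this Suc] show ?case by (simp add: u_add)
  qed
  \<comment> \<open>The coefficients in the basis may be negative. \<open>nat a\<close> and
    \<open>nat (- a)\<close> are the positive and negative parts of \<open>a\<close>; moving the
    negative parts to the other side gives an equation of exponent vectors to which
    \<open>S_cancel\<close> applies.\<close>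
  let ?v = "\<lambda>a b. u (nat a * nat p + nat b * nat r) (nat a * nat q + nat b * nat s)"
  have v: "?v a b \<in> S" for a b
    using S_add[OF u_mult u_mult] pq rs by (simp flip: u_add)
  have pm: "int (nat x) - int (nat (- x)) = x" for x by simp
  have "u (deg_on I m) (deg_on J m) + ?v (- a) (- b) = ?v a b"
  proof -
    have "int (deg_on I m + (nat (-a) * nat p + nat (-b) * nat r)) = int (nat a * nat p + nat b * nat r)"
      using pm[of a] pm[of b] pq rs ab(1) by (simp add: algebra_simps flip: left_diff_distrib)
    moreover have "int (deg_on J m + (nat (-a) * nat q + nat (-b) * nat s)) = int (nat a * nat q + nat b * nat s)"
      using pm[of a] pm[of b] pq rs ab(2) by (simp add: algebra_simps flip: left_diff_distrib)
    ultimately show ?thesis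
      unfolding u_add of_nat_eq_iff by simp
  qed
  then have um: "u (deg_on I m) (deg_on J m) \<in> S"
    using S_cancel v by metis
  \<comment> \<open>Cancelling \<open>u\<close> of the bidegree of \<open>m\<close> puts the
    correction into \<open>S\<close>; it can then be cancelled from its sum with
    \<open>m\<close>.\<close>
  have "W (deg_on I m) (deg_on J m) \<in> S"
    using W[of "u (deg_on I m) (deg_on J m)"] S_cancel um by (simp add: deg_u add.commute)
  then show ?thesis
    using W S_cancel by blast
qed

section \<open>Simultaneous diagonalization\<close>

text \<open>Multiplication by a root \<open>w\<close> permutes the roots and scales the sum by
  \<open>w ^ j\<close>. A root with \<open>w ^ j\<close> different from 1 exists because at most
  \<open>j < N\<close> elements satisfy \<open>z ^ j = 1\<close>.\<close>

lemma sum_roots_of_unity_power: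
  assumes card: "card {z :: 'e::field. z ^ N = 1} = N" and j: "0 < j" "j < N"
  shows "(\<Sum>z | z ^ N = (1::'e). z ^ j) = 0"
proof -
  let ?Z = "{z :: 'e. z ^ N = 1}"
  have fin: "finite ?Z"
    using card j by (metis card.infinite not_less_zero)
  have "\<exists>w\<in>?Z. w ^ j \<noteq> 1"
  proof (rule ccontr)
    assume all: "\<not> (\<exists>w\<in>?Z. w ^ j \<noteq> 1)"
    let ?p = "Polynomial.monom 1 j - 1 :: 'e poly"
    have deg: "Polynomial.degree ?p \<le> j"
      by (intro degree_diff_le) (auto simp: degree_monom_eq)
    have "Polynomial.coeff ?p j = 1" using j by simp
    then have "?p \<noteq> 0" by force
    then have "card {z. poly ?p z = 0} \<le> j" "finite {z. poly ?p z = 0}"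
      using card_poly_roots_bound[of ?p] poly_roots_finite[of ?p] deg by auto
    moreover have "?Z \<subseteq> {z. poly ?p z = 0}"
      using all by (auto simp: poly_monom)
    ultimately have "card ?Z \<le> j"
      by (meson card_mono le_trans)
    then show False using card j by simp
  qed
  then obtain w :: 'e where w: "w ^ N = 1" "w ^ j \<noteq> 1" by auto
  have w0: "w \<noteq> 0" using w j by (metis not_less_zero power_eq_0_iff zero_neq_one power_0_left)
  have "(\<Sum>z\<in>?Z. z ^ j) = (\<Sum>z\<in>?Z. (w * z) ^ j)"
    by (rule sum.reindex_bij_witness[of _ "\<lambda>z. w * z" "\<lambda>z. inverse w * z"])
      (use w w0 in \<open>auto simp: power_mult_distrib power_inverse\<close>)
  also have "\<dots> = w ^ j * (\<Sum>z\<in>?Z. z ^ j)"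
    by (simp add: power_mult_distrib sum_distrib_left)
  finally show ?thesis using w by simp
qed

text \<open>Induction on \<open>S\<close>: a joint eigenvector for \<open>S\<close> is split into
  eigenvectors of the new matrix \<open>M h\<close> by Fourier analysis over the \<open>N\<close>th
  roots of unity, and since the matrices commute the pieces remain eigenvectors for
  \<open>S\<close>.\<close>

lemma span_simultaneous_eigenvectors:
  fixes M :: "'g \<Rightarrow> ('e::field, 'n::finite) sqmat"
  assumes "finite S"
    and card: "card {z :: 'e. z ^ N = 1} = N" and N: "of_nat N \<noteq> (0 :: 'e)"
    and pow: "\<And>g v. g \<in> S \<Longrightarrow> ((*v) (M g) ^^ N) v = v"
    and comm: "\<And>g h. g \<in> S \<Longrightarrow> h \<in> S \<Longrightarrow> M g ** M h = M h ** M g"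
  shows "vec.span {v. \<forall>g\<in>S. \<exists>c. M g *v v = c *s v} = UNIV"
  using assms(1) pow comm
proof (induction S)
  case (insert h S)
  let ?E = "\<lambda>S. {v. \<forall>g\<in>S. \<exists>c. M g *v v = c *s v}"
  have "?E S \<subseteq> vec.span (?E (insert h S))"
  proof
    fix v assume v: "v \<in> ?E S"
    let ?T = "(*v) (M h)"
    let ?Z = "{z :: 'e. z ^ N = 1}"
    have N0: "N > 0" using N by (cases N) auto
    have linT: "?T (\<Sum>j\<in>A. x j) = (\<Sum>j\<in>A. ?T (x j))" "?T (a *s y) = a *s ?T y"
      for x :: "nat \<Rightarrow> 'e^'n" and A a y
      by (rule vec.linear_sum vec.linear_scale; rule matrix_vector_mul_linear_gen)+
    \<comment> \<open>Up to the factor \<open>N\<close>, the projection of \<open>v\<close> to the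
      eigenspace of \<open>M h\<close> for the eigenvalue \<open>inverse z\<close>.\<close>
    define y where "y = (\<lambda>z :: 'e. \<Sum>j<N. z ^ j *s (?T ^^ j) v)"
    have eig: "?T (y z) = inverse z *s y z" if z: "z \<in> ?Z" for z
    proof -
      have z0: "z \<noteq> 0" using z N0 by (auto simp: power_0_left)
      let ?f = "\<lambda>j. z ^ j *s (?T ^^ j) v"
      \<comment> \<open>Applying \<open>z\<close> times \<open>M h\<close> shifts the summation
        index by one; the boundary terms at 0 and \<open>N\<close> agree because
        \<open>z ^ N = 1\<close> and the \<open>N\<close>th iterate of \<open>M h\<close> fixes
        \<open>v\<close>.\<close>
      have "z *s ?T (y z) = (\<Sum>j<N. ?f (Suc j))"
        by (simp add: y_def linT vec.scale_sum_right)
      also have "\<dots> = (\<Sum>j<Suc N. ?f j) - ?f 0"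
        by (subst sum.lessThan_Suc_shift) simp
      also have "\<dots> = y z"
        using z insert.prems(1)[of h v] by (simp add: y_def)
      finally have "inverse z *s (z *s ?T (y z)) = inverse z *s y z" by simp
      then show ?thesis using z0 by simp
    qed
    have eigS: "M g *v y z = c *s y z" if g: "g \<in> S" and c: "M g *v v = c *s v" for g c z
    proof -
      have "M g *v (?T ^^ j) v = c *s (?T ^^ j) v" for j
      proof (induction j)
        case (Suc j)
        have "M g *v (?T ^^ Suc j) v = ?T (M g *v (?T ^^ j) v)"
          using insert.prems(2)[of g h] g by (simp add: matrix_vector_mul_assoc)
        then show ?case by (simp add: Suc linT)
      qed (simp add: c)
      then show ?thesis
        by (simp add: y_def vec.scale_sum_right
            vec.linear_sum[OF matrix_vector_mul_linear_gen] vec.linear_scale[OF matrix_vector_mul_linear_gen]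
            mult.commute)
    qed
    \<comment> \<open>Fourier inversion: summing over all roots kills every term but
      \<open>j = 0\<close>, and \<open>N\<close> is invertible in \<open>'e\<close>.\<close>
    have "(\<Sum>z\<in>?Z. y z) = (\<Sum>j<N. (\<Sum>z\<in>?Z. z ^ j) *s (?T ^^ j) v)"
      unfolding y_def by (subst sum.swap) (simp add: vec.scale_sum_left)
    also have "\<dots> = (\<Sum>j<N. if j = 0 then of_nat N *s v else 0)"
      by (intro sum.cong) (auto simp: sum_roots_of_unity_power[OF card] card)
    also have "\<dots> = of_nat N *s v"
      using N0 by simp
    finally have "inverse (of_nat N) *s (\<Sum>z\<in>?Z. y z) = inverse (of_nat N) *s (of_nat N *s v)"
      by simp
    then have "v = inverse (of_nat N) *s (\<Sum>z\<in>?Z. y z)"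
      using N by simp
    also have "\<dots> \<in> vec.span (?E (insert h S))"
      using v eig eigS by (intro vec.span_scale vec.span_sum vec.span_base) blast
    finally show "v \<in> vec.span (?E (insert h S))" .
  qed
  moreover have "vec.span (?E S) = UNIV"
    using insert by auto
  ultimately show ?case
    using vec.span_minimal[OF _ vec.subspace_span, of "?E S" "?E (insert h S)"] by auto
qed simp

text \<open>A maximal independent set of joint eigenvectors is a basis and supplies the columns of
  \<open>P\<close>.\<close>

lemma simultaneous_diagonalization:
  fixes M :: "'g \<Rightarrow> ('e::field, 'n::finite) sqmat"
  assumes "vec.span {v. \<forall>g\<in>S. \<exists>c. M g *v v = c *s v} = UNIV"
  obtains P :: "('e, 'n) sqmat" and c where "invertible P" and "\<And>i. column i P \<noteq> 0"
    and "\<And>g i. g \<in> S \<Longrightarrow> M g *v column i P = c g i *s column i P"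
proof -
  let ?E = "{v. \<forall>g\<in>S. \<exists>c. M g *v v = c *s v}"
  obtain B where B: "B \<subseteq> ?E" "vec.independent B" "?E \<subseteq> vec.span B"
    using vec.maximal_independent_subset by blast
  have span: "vec.span B = UNIV"
    using vec.span_minimal[OF B(3) vec.subspace_span] assms by auto
  then have "card B = CARD('n)"
    using vec.dim_eq_card_independent[OF B(2)] vec.dim_span[of B] vec_dim_card by metis
  moreover have "finite B"
    using B(2) by (rule vec.finiteI_independent)
  ultimately obtain f where f: "bij_betw f (UNIV :: 'n set) B"
    using finite_same_card_bij[of "UNIV :: 'n set" B] by auto
  have fB: "f i \<in> B" for i
    using f by (auto simp: bij_betw_def)
  define P :: "('e, 'n) sqmat" where "P = (\<chi> i j. f j $ i)"
  have col: "column i P = f i" for i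
    by (simp add: P_def column_def vec_eq_iff)
  have "columns P = B"
    using f by (auto simp: columns_def col bij_betw_def)
  then have "\<exists>P'. P ** P' = mat 1"
    using span by (simp add: matrix_right_invertible_span_columns)
  then have inv: "invertible P"
    by (simp add: invertible_right_inverse)
  have nz: "column i P \<noteq> 0" for i
    using B(2) fB[of i] vec.dependent_zero[of B] by (auto simp: col)
  have "\<forall>g\<in>S. \<forall>i. \<exists>c. M g *v column i P = c *s column i P"
    using B(1) fB by (auto simp: col)
  then obtain c where "\<And>g i. g \<in> S \<Longrightarrow> M g *v column i P = c g i *s column i P"
    by metis
  then show ?thesis
    by (rule that[OF inv nz])
qed

lemma matrix_mult_eq_diagonal:
  fixes A P :: "('e::field, 'n::finite) sqmat"
  assumes "\<And>i. A *v column i P = c i *s column i P"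
  shows "A ** P = P ** (\<chi> i j. if i = j then c i else 0)"
proof -
  have "(A ** P) $ i $ j = (P ** (\<chi> i j. if i = j then c i else 0)) $ i $ j" for i j
  proof -
    have "(A ** P) $ i $ j = (A *v column j P) $ i"
      by (simp add: matrix_matrix_mult_def matrix_vector_mult_def column_def)
    also have "\<dots> = c j * P $ i $ j"
      by (simp only: assms) (simp add: column_def)
    also have "\<dots> = (P ** (\<chi> i j. if i = j then c i else 0)) $ i $ j"
      by (simp add: matrix_matrix_mult_def if_distrib mult.commute cong: if_cong)
    finally show ?thesis .
  qed
  then show ?thesis
    by (simp add: vec_eq_iff)
qed

section \<open>Polynomials: degrees, diagonal substitutions and weights\<close>

lemma lookup_map:
  assumes "l 0 = 0"
  shows "Poly_Mapping.lookup (Poly_Mapping.map l f) m = l (Poly_Mapping.lookup f m)"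
  using assms by (auto simp: Poly_Mapping.map.rep_eq when_def)

lemma additive_sum:
  fixes T :: "'a::comm_monoid_add \<Rightarrow> 'b::comm_monoid_add"
  assumes "T 0 = 0" "\<And>x y. T (x + y) = T x + T y"
  shows "T (sum f A) = (\<Sum>x\<in>A. T (f x))"
  by (induction A rule: infinite_finite_induct) (auto simp: assms)

lemma poly_mapping_decomp:
  "f = (\<Sum>m\<in>Poly_Mapping.keys f. Poly_Mapping.single m (Poly_Mapping.lookup f m))"
  by (rule poly_mapping_eqI)
     (simp add: lookup_sum lookup_single when_def sum.delta' in_keys_iff)

text \<open>Both sides are additive in \<open>f\<close> and in \<open>g\<close>, and every element
  is a sum of single terms. Serves to show that \<open>twist\<close> and \<open>ext\<close> are
  multiplicative.\<close>

lemma multiplicative_if_on_singles: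
  fixes T :: "('a::monoid_add \<Rightarrow>\<^sub>0 'b::semiring_0) \<Rightarrow> 'c::semiring_0"
  assumes zero: "T 0 = 0" and add: "\<And>f g. T (f + g) = T f + T g"
    and single: "\<And>m n a b. T (Poly_Mapping.single m a * Poly_Mapping.single n b) =
      T (Poly_Mapping.single m a) * T (Poly_Mapping.single n b)"
  shows "T (f * g) = T f * T g"
proof -
  let ?S = "\<lambda>f m. Poly_Mapping.single m (Poly_Mapping.lookup f m)"
  note sum = additive_sum[of T, OF zero add]
  have T: "T f = (\<Sum>m\<in>Poly_Mapping.keys f. T (?S f m))" for f
    by (subst (1) poly_mapping_decomp) (rule sum)
  have "f * g = (\<Sum>m\<in>Poly_Mapping.keys f. ?S f m) * (\<Sum>m\<in>Poly_Mapping.keys g. ?S g m)"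
    using poly_mapping_decomp[of f] poly_mapping_decomp[of g] by metis
  then show ?thesis
    by (simp add: sum_product sum single T[of f] T[of g])
qed

lemma lookup_mconst_mult:
  "Poly_Mapping.lookup (mconst c * f) m = c * Poly_Mapping.lookup f m"
proof -
  have "mconst c * f = (\<Sum>m\<in>Poly_Mapping.keys f. Poly_Mapping.single m (c * Poly_Mapping.lookup f m))"
    by (subst (1) mpoly_decomp) (simp add: sum_distrib_left mconst_def mult_single)
  also have "\<dots> = Poly_Mapping.map ((*) c) f"
    by (rule poly_mapping_eqI)
       (auto simp: lookup_map lookup_sum lookup_single when_def sum.delta' in_keys_iff)
  finally show ?thesis
    by (simp add: lookup_map)
qed

lemma mconst_0 [simp]: "mconst 0 = 0" and mconst_1 [simp]: "mconst 1 = 1"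
  by (simp_all add: mconst_def)

lemma lin_subst_add: "lin_subst A (f + g) = lin_subst A f + lin_subst A g"
  by (simp add: lin_subst_def msubst_add)

lemma lin_subst_sum: "lin_subst A (sum f S) = (\<Sum>x\<in>S. lin_subst A (f x))"
  by (simp add: lin_subst_def msubst_sum)

lemma lin_subst_prod: "lin_subst A (prod f S) = (\<Prod>x\<in>S. lin_subst A (f x))"
  by (simp add: lin_subst_def msubst_prod)

lemma lin_subst_power: "lin_subst A (f ^ n) = lin_subst A f ^ n"
  by (simp add: lin_subst_def msubst_power)

lemma lin_subst_mconst [simp]: "lin_subst A (mconst c) = mconst c"
  by (simp add: lin_subst_def)

lemma total_degree_le_iff:
  "total_degree f \<le> d \<longleftrightarrow> (\<forall>m\<in>Poly_Mapping.keys f. (\<Sum>i\<in>UNIV. Poly_Mapping.lookup m i) \<le> d)"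
  unfolding total_degree_def by (subst Max_le_iff) auto

lemma total_degree_ge:
  "m \<in> Poly_Mapping.keys f \<Longrightarrow> (\<Sum>i\<in>UNIV. Poly_Mapping.lookup m i) \<le> total_degree f"
  using total_degree_le_iff[of f "total_degree f"] by auto

lemma total_degree_sum_le:
  assumes "\<And>x. x \<in> S \<Longrightarrow> total_degree (f x) \<le> d"
  shows "total_degree (sum f S) \<le> d"
proof -
  have "Poly_Mapping.keys (sum f S) \<subseteq> (\<Union>x\<in>S. Poly_Mapping.keys (f x))"
    by (rule keys_sum)
  then show ?thesis
    using assms by (auto simp: total_degree_le_iff)
qed

lemma total_degree_mult_le: "total_degree (f * g) \<le> total_degree f + total_degree g"
  unfolding total_degree_le_iff
proof
  fix m assume "m \<in> Poly_Mapping.keys (f * g)"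
  then obtain a b where "m = a + b" "a \<in> Poly_Mapping.keys f" "b \<in> Poly_Mapping.keys g"
    using keys_mult[of f g] by blast
  then show "(\<Sum>i\<in>UNIV. Poly_Mapping.lookup m i) \<le> total_degree f + total_degree g"
    using add_mono[OF total_degree_ge total_degree_ge] by (simp add: lookup_add sum.distrib)
qed

lemma total_degree_mconst [simp]: "total_degree (mconst c) = 0"
  using total_degree_le_iff[of "mconst c" 0] by (auto simp: mconst_def split: if_splits)

lemma total_degree_mvar_le: "total_degree (mvar i) \<le> 1"
  by (auto simp: total_degree_le_iff mvar_def lookup_single when_def)

lemma total_degree_power_le: "total_degree (f ^ n) \<le> n * total_degree f"
proof (induction n)
  case 0
  then show ?case using total_degree_mconst[of 1] by simp
next
  case (Suc n)
  then show ?case using total_degree_mult_le[of f "f ^ n"] by simp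
qed

lemma total_degree_prod_le: "total_degree (prod f S) \<le> (\<Sum>x\<in>S. total_degree (f x))"
proof (induction S rule: infinite_finite_induct)
  case (insert x S)
  then show ?case using total_degree_mult_le[of "f x" "prod f S"] by simp
qed (use total_degree_mconst[of 1] in simp_all)

lemma total_degree_lin_subst_le:
  fixes f :: "('k::field, 'n::finite) mpoly"
  shows "total_degree (lin_subst A f) \<le> total_degree f"
proof -
  let ?s = "\<lambda>i. \<Sum>j\<in>UNIV. mconst (A $ i $ j) * mvar j"
  have s: "total_degree (?s i) \<le> 1" for i
  proof (rule total_degree_sum_le)
    fix j
    show "total_degree (mconst (A $ i $ j) * mvar j) \<le> 1"
      by (rule order_trans[OF total_degree_mult_le]) (simp add: total_degree_mvar_le[unfolded One_nat_def])
  qed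
  have "total_degree (mconst (Poly_Mapping.lookup f m) * (\<Prod>i\<in>UNIV. ?s i ^ Poly_Mapping.lookup m i))
    \<le> total_degree f" if m: "m \<in> Poly_Mapping.keys f" for m
  proof -
    have pw: "total_degree (?s i ^ Poly_Mapping.lookup m i) \<le> Poly_Mapping.lookup m i" for i
      by (rule order_trans[OF total_degree_power_le]) (metis mult.right_neutral mult_le_mono2 s)
    have "total_degree (\<Prod>i\<in>UNIV. ?s i ^ Poly_Mapping.lookup m i) \<le> (\<Sum>i\<in>UNIV. Poly_Mapping.lookup m i)"
      by (rule order_trans[OF total_degree_prod_le sum_mono[OF pw]])
    also have "\<dots> \<le> total_degree f"
      using m by (rule total_degree_ge)
    finally show ?thesis
      using total_degree_mult_le[of "mconst (Poly_Mapping.lookup f m)"]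
      by (metis (no_types, lifting) add_0 le_trans total_degree_mconst)
  qed
  then show ?thesis
    unfolding lin_subst_def msubst_def by (rule total_degree_sum_le)
qed

lemma lookup_lin_subst_diagonal:
  fixes f :: "('k::field, 'n::finite) mpoly"
  assumes A: "\<And>i j. A $ i $ j = (if i = j then c i else 0)"
  shows "Poly_Mapping.lookup (lin_subst A f) m =
    (\<Prod>i\<in>UNIV. c i ^ Poly_Mapping.lookup m i) * Poly_Mapping.lookup f m"
proof -
  have s: "(\<Sum>j\<in>UNIV. mconst (A $ i $ j) * mvar j) = mconst (c i) * mvar i" for i
    by (subst sum.remove[of _ i]) (auto simp: A intro!: sum.neutral)
  have mono: "(\<Prod>i\<in>UNIV. mvar i ^ Poly_Mapping.lookup m i) = Poly_Mapping.single m (1 :: 'k)"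
    for m :: "'n \<Rightarrow>\<^sub>0 nat"
    using msubst_single[of mvar m "1 :: 'k"] by (simp add: msubst_id mconst_def)
  have pw: "mconst x ^ n = mconst (x ^ n)" for x :: 'k and n
    by (induction n) (auto simp: mconst_mult)
  have pr: "(\<Prod>i\<in>S. mconst (x i)) = mconst (\<Prod>i\<in>S. x i)" for x :: "'n \<Rightarrow> 'k" and S
    by (induction S rule: infinite_finite_induct) (auto simp: mconst_mult)
  have "lin_subst A f = (\<Sum>m\<in>Poly_Mapping.keys f. Poly_Mapping.single m
      ((\<Prod>i\<in>UNIV. c i ^ Poly_Mapping.lookup m i) * Poly_Mapping.lookup f m))"
    unfolding lin_subst_def s msubst_def
    by (simp add: power_mult_distrib prod.distrib mono pw pr flip: mconst_mult)
       (simp add: mconst_def mult_single mult_ac)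
  then show ?thesis
    by (auto simp: lookup_sum lookup_single when_def sum.delta' in_keys_iff)
qed

section \<open>Weights and twists\<close>

definition weight :: "('n::finite \<Rightarrow> int) \<Rightarrow> ('n \<Rightarrow>\<^sub>0 nat) \<Rightarrow> int" where
  "weight w m = (\<Sum>i\<in>UNIV. w i * int (Poly_Mapping.lookup m i))"

text \<open>The substitution \<open>x\<^sub>i \<mapsto> T\<^bsup>r w i\<^esup> x\<^sub>i\<close> into the Laurent polynomials in \<open>T\<close>.\<close>

definition twist :: "('n::finite \<Rightarrow> int) \<Rightarrow> int \<Rightarrow> ('k::field, 'n) mpoly \<Rightarrow> int \<Rightarrow>\<^sub>0 ('k, 'n) mpoly" where
  "twist w r f = (\<Sum>m\<in>Poly_Mapping.keys f.
     Poly_Mapping.single (r * weight w m) (Poly_Mapping.single m (Poly_Mapping.lookup f m)))"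

lemma weight_add: "weight w (m + n) = weight w m + weight w n"
  by (simp add: weight_def lookup_add algebra_simps sum.distrib)

lemma lookup_twist:
  fixes f :: "('k::field, 'n::finite) mpoly"
  shows "Poly_Mapping.lookup (Poly_Mapping.lookup (twist w r f) k) m =
    (if k = r * weight w m then Poly_Mapping.lookup f m else 0)"
proof -
  have "Poly_Mapping.lookup (Poly_Mapping.lookup
      (Poly_Mapping.single (r * weight w n) (Poly_Mapping.single n c)) k) m =
      (if n = m then (if k = r * weight w m then c else 0) else 0)" for n and c :: 'k
    by (simp add: lookup_single when_def)
  then show ?thesis
    by (simp add: twist_def lookup_sum sum.delta in_keys_iff)
qed

lemma twist_add: "twist w r (f + g) = twist w r f + twist w r g"
  by (intro poly_mapping_eqI) (simp add: lookup_twist lookup_add)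

lemma twist_single:
  "twist w r (Poly_Mapping.single m a) = Poly_Mapping.single (r * weight w m) (Poly_Mapping.single m a)"
  by (simp add: twist_def)

lemma twist_mult: "twist w r (f * g) = twist w r f * twist w r g"
  by (rule multiplicative_if_on_singles[of "twist w r"])
     (simp_all add: twist_add twist_single mult_single weight_add distrib_left, simp add: twist_def)

lemma twist_weight_0:
  assumes "\<And>m. m \<in> Poly_Mapping.keys f \<Longrightarrow> weight w m = 0"
  shows "twist w r f = Poly_Mapping.single 0 f"
  by (intro poly_mapping_eqI) (use assms in \<open>auto simp: lookup_twist lookup_single when_def in_keys_iff\<close>)

text \<open>A root of nonzero weight would have infinitely many conjugates under the torus of twists.\<close>

lemma weight_0_if_algebraic:
  fixes F :: "('k::field, 'n::{finite,linorder}) mpoly"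
  assumes root: "(\<Sum>j\<in>J. A j * F ^ j) = 0" and "finite J" "j \<in> J" "A j \<noteq> 0"
    and A: "\<And>j m. j \<in> J \<Longrightarrow> m \<in> Poly_Mapping.keys (A j) \<Longrightarrow> weight w m = 0"
    and m: "m \<in> Poly_Mapping.keys F"
  shows "weight w m = 0"
proof (rule ccontr)
  assume w: "weight w m \<noteq> 0"
  \<comment> \<open>The coefficients \<open>A j\<close> are placed in Laurent degree 0, where
    twisting leaves them because their weights vanish. Hence every twist of \<open>F\<close> is a
    root of \<open>P\<close>.\<close>
  define P where "P = (\<Sum>j\<in>J. Polynomial.monom (Poly_Mapping.single (0::int) (A j)) j)"
  have "Polynomial.coeff P j = Poly_Mapping.single 0 (A j)"
    using assms(2,3) by (simp add: P_def coeff_sum sum.delta)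
  then have "P \<noteq> 0"
    using \<open>A j \<noteq> 0\<close> by (metis coeff_0 lookup_single_eq lookup_zero)
  then have fin: "finite {x. poly P x = 0}"
    by (rule poly_roots_finite)
  have zero: "twist w r (0 :: ('k, 'n) mpoly) = 0" for r :: int
    by (simp add: twist_def)
  have one: "twist w r (1 :: ('k, 'n) mpoly) = 1" for r :: int
    using twist_single[of w r 0 "1 :: 'k"] by (simp add: weight_def)
  have power: "twist w r (F ^ j) = twist w r F ^ j" for r j
    by (induction j) (auto simp: twist_mult one)
  have "poly P (twist w r F) = 0" for r
  proof -
    have "poly P (twist w r F) = (\<Sum>j\<in>J. twist w r (A j) * twist w r F ^ j)"
      unfolding P_def poly_sum poly_monom
      by (intro sum.cong refl) (simp add: twist_weight_0[OF A])
    also have "\<dots> = twist w r (\<Sum>j\<in>J. A j * F ^ j)"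
      by (simp add: additive_sum[of "twist w r"] zero twist_add twist_mult power)
    finally show ?thesis by (simp add: root zero)
  qed
  then have "finite (range (\<lambda>r. twist w r F))"
    by (intro finite_subset[OF _ fin]) auto
  \<comment> \<open>The coefficient of \<open>F\<close> at \<open>m\<close> sits at Laurent exponent
    \<open>r * weight w m\<close>, from which \<open>r\<close> can be read off as the weight is
    nonzero.\<close>
  moreover have "inj (\<lambda>r. twist w r F)"
  proof (rule injI)
    fix r s assume "twist w r F = twist w s F"
    then have "Poly_Mapping.lookup (Poly_Mapping.lookup (twist w s F) (r * weight w m)) m = Poly_Mapping.lookup F m"
      using lookup_twist[of w r F "r * weight w m" m] by simp
    then show "r = s"
      using m w by (auto simp: lookup_twist in_keys_iff split: if_splits)
  qed
  ultimately show False
    using finite_imageD infinite_UNIV_int by blast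
qed

section \<open>Extension of the base field\<close>

locale field_embedding =
  fixes \<phi> :: "'k::field \<Rightarrow> 'e::field"
  assumes add: "\<phi> (x + y) = \<phi> x + \<phi> y"
    and mult: "\<phi> (x * y) = \<phi> x * \<phi> y"
    and one: "\<phi> 1 = 1"
begin

lemma zero [simp]: "\<phi> 0 = 0"
  using add[of 0 0] by (metis add.right_neutral add_left_cancel)

lemma eq_0_iff [simp]: "\<phi> x = 0 \<longleftrightarrow> x = 0"
proof
  assume "\<phi> x = 0"
  then have "\<phi> (x * inverse x) = 0" by (simp add: mult)
  then show "x = 0" using one by (cases "x = 0") auto
qed simp

lemma of_nat: "\<phi> (of_nat n) = of_nat n"
  by (induction n) (auto simp: add one)

lemma sum: "\<phi> (sum f S) = (\<Sum>x\<in>S. \<phi> (f x))"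
  by (rule additive_sum) (simp_all add: add)

sublocale vs: vector_space "\<lambda>c x. \<phi> c * x"
  by unfold_locales (auto simp: algebra_simps add mult one)

text \<open>A Hamel basis of \<open>'e\<close> over the image of \<open>'k\<close>, possibly
  infinite: the extension may have any degree.\<close>

definition basis :: "'e set" where
  "basis = vs.extend_basis {}"

definition coord :: "'e \<Rightarrow> 'e \<Rightarrow> 'k" where
  "coord b x = vs.representation basis x b"

lemma basis: "vs.independent basis" "vs.span basis = UNIV"
  unfolding basis_def
  by (rule vs.independent_extend_basis vs.span_extend_basis; rule vs.independent_empty)+

lemma coord_0 [simp]: "coord b 0 = 0"
  by (simp add: coord_def vs.representation_zero)

lemma coord_add: "coord b (x + y) = coord b x + coord b y"
  unfolding coord_def by (subst vs.representation_add) (auto simp: basis)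

lemma coord_scale: "coord b (x * \<phi> c) = coord b x * c"
proof -
  have "x \<in> vs.span basis" by (simp only: basis UNIV_I)
  from fun_cong[OF vs.representation_scale[OF basis(1) this, of c], of b] show ?thesis
    by (simp only: coord_def mult.commute)
qed

lemma coord_expansion:
  assumes "finite B" "{b. coord b x \<noteq> 0} \<subseteq> B"
  shows "(\<Sum>b\<in>B. b * \<phi> (coord b x)) = x"
proof -
  have "(\<Sum>b | coord b x \<noteq> 0. \<phi> (coord b x) * b) = x"
    unfolding coord_def by (rule vs.sum_nonzero_representation_eq) (auto simp: basis)
  also have "(\<Sum>b | coord b x \<noteq> 0. \<phi> (coord b x) * b) = (\<Sum>b\<in>B. \<phi> (coord b x) * b)"
    by (rule sum.mono_neutral_left) (use assms in auto)
  finally show ?thesis by (simp add: mult.commute)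
qed

definition ext :: "('k, 'n) mpoly \<Rightarrow> ('e, 'n) mpoly" where
  "ext = Poly_Mapping.map \<phi>"

text \<open>Taken coefficientwise, a coordinate functional becomes a map down to polynomials over
  \<open>'k\<close> that is linear over the polynomials over \<open>'k\<close>
  (\<open>mcoord_ext_mult\<close>) and commutes with the group (\<open>mcoord_lin_subst\<close>).
  This is the means of descent.\<close>

definition mcoord :: "'e \<Rightarrow> ('e, 'n) mpoly \<Rightarrow> ('k, 'n) mpoly" where
  "mcoord b = Poly_Mapping.map (coord b)"

definition extmat :: "('k, 'n::finite) sqmat \<Rightarrow> ('e, 'n) sqmat" where
  "extmat A = (\<chi> i j. \<phi> (A $ i $ j))"

lemma extmat_mult: "extmat (A ** B) = extmat A ** extmat B"
  by (simp add: vec_eq_iff extmat_def matrix_matrix_mult_def mult sum)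

lemma extmat_mat_1: "extmat (mat 1) = mat 1"
  by (simp add: vec_eq_iff extmat_def mat_def one)

lemma lookup_ext: "Poly_Mapping.lookup (ext f) m = \<phi> (Poly_Mapping.lookup f m)"
  by (simp add: ext_def lookup_map)

lemma lookup_mcoord: "Poly_Mapping.lookup (mcoord b F) m = coord b (Poly_Mapping.lookup F m)"
  by (simp add: mcoord_def lookup_map)

lemma keys_ext [simp]: "Poly_Mapping.keys (ext f) = Poly_Mapping.keys f"
  by (auto simp: in_keys_iff lookup_ext)

lemma keys_mcoord_subset: "Poly_Mapping.keys (mcoord b F) \<subseteq> Poly_Mapping.keys F"
  by (auto simp: in_keys_iff lookup_mcoord)

lemma total_degree_ext [simp]: "total_degree (ext f) = total_degree f"
  by (simp add: total_degree_def)

lemma total_degree_mcoord_le: "total_degree (mcoord b F) \<le> total_degree F"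
  using total_degree_ge keys_mcoord_subset[of b F] by (fastforce simp: total_degree_le_iff)

lemma ext_0 [simp]: "ext 0 = 0" and mcoord_0 [simp]: "mcoord b 0 = 0"
  by (auto intro!: poly_mapping_eqI simp: lookup_ext lookup_mcoord)

lemma ext_eq_0_iff [simp]: "ext f = 0 \<longleftrightarrow> f = 0"
  using keys_ext[of f] by (metis keys_eq_empty)

lemma ext_add: "ext (f + g) = ext f + ext g"
  by (intro poly_mapping_eqI) (simp add: lookup_ext lookup_add add)

lemma mcoord_add: "mcoord b (f + g) = mcoord b f + mcoord b g"
  by (intro poly_mapping_eqI) (simp add: lookup_mcoord lookup_add coord_add)

lemma ext_sum: "ext (sum f A) = (\<Sum>x\<in>A. ext (f x))"
  by (rule additive_sum) (simp_all add: ext_add)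

lemma mcoord_sum: "mcoord b (sum f A) = (\<Sum>x\<in>A. mcoord b (f x))"
  by (rule additive_sum) (simp_all add: mcoord_add)

lemma ext_single: "ext (Poly_Mapping.single m c) = Poly_Mapping.single m (\<phi> c)"
  by (intro poly_mapping_eqI) (simp add: lookup_ext lookup_single when_def)

lemma ext_mconst [simp]: "ext (mconst c) = mconst (\<phi> c)"
  by (simp add: mconst_def ext_single)

lemma ext_1 [simp]: "ext 1 = 1"
  using ext_mconst[of 1] by (simp add: one)

lemma ext_mvar [simp]: "ext (mvar i) = mvar i"
  by (simp add: mvar_def ext_single one)

lemma ext_mult: "ext (f * g) = ext f * ext g"
  by (rule multiplicative_if_on_singles[of ext]) (simp_all add: ext_add ext_single mult_single mult)

lemma ext_power: "ext (f ^ n) = ext f ^ n"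
  by (induction n) (auto simp: ext_mult)

lemma ext_prod: "ext (prod f A) = (\<Prod>x\<in>A. ext (f x))"
  by (induction A rule: infinite_finite_induct) (auto simp: ext_mult)

lemma ext_lin_subst: "ext (lin_subst A f) = lin_subst (extmat A) (ext f)"
  unfolding lin_subst_def msubst_def
  by (simp add: ext_sum ext_mult ext_prod ext_power extmat_def lookup_ext)

lemma mcoord_mconst_mult: "mcoord b (mconst c * ext f) = mconst (coord b c) * f"
  by (intro poly_mapping_eqI) (simp add: lookup_mcoord lookup_mconst_mult lookup_ext coord_scale)

text \<open>A polynomial has finitely many coefficients, each with finitely many nonzero
  coordinates, so finitely many basis elements suffice.\<close>

lemma mcoord_expansion:
  obtains B where "finite B" "F = (\<Sum>b\<in>B. mconst b * ext (mcoord b F))"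
proof
  let ?B = "\<Union>m\<in>Poly_Mapping.keys F. {b. coord b (Poly_Mapping.lookup F m) \<noteq> 0}"
  show fin: "finite ?B"
    unfolding coord_def by (auto intro: vs.finite_representation)
  show "F = (\<Sum>b\<in>?B. mconst b * ext (mcoord b F))"
  proof (rule poly_mapping_eqI)
    fix m
    have "(\<Sum>b\<in>?B. b * \<phi> (coord b (Poly_Mapping.lookup F m))) = Poly_Mapping.lookup F m"
    proof (rule coord_expansion[OF fin])
      show "{b. coord b (Poly_Mapping.lookup F m) \<noteq> 0} \<subseteq> ?B"
        by (cases "m \<in> Poly_Mapping.keys F") (auto simp: in_keys_iff)
    qed
    then show "Poly_Mapping.lookup F m = Poly_Mapping.lookup (\<Sum>b\<in>?B. mconst b * ext (mcoord b F)) m"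
      by (simp add: lookup_sum lookup_mconst_mult lookup_ext lookup_mcoord)
  qed
qed

lemma mcoord_eq_0:
  assumes "\<And>b. mcoord b F = 0"
  shows "F = 0"
  using mcoord_expansion[of F] assms by (metis (no_types, lifting) ext_0 mult_zero_right sum.neutral)

lemma mcoord_ext_mult: "mcoord b (ext f * F) = f * mcoord b F"
proof -
  obtain B where F: "F = (\<Sum>b\<in>B. mconst b * ext (mcoord b F))"
    using mcoord_expansion by blast
  \<comment> \<open>The claim is proved for an arbitrary family \<open>g\<close>, since rewriting
    \<open>F\<close> by its expansion would also rewrite the \<open>F\<close> inside its
    coordinates.\<close>
  have "mcoord b (ext f * (\<Sum>c\<in>B. mconst c * ext (g c))) =
      f * mcoord b (\<Sum>c\<in>B. mconst c * ext (g c))" for g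
    by (simp add: sum_distrib_left mcoord_sum mcoord_mconst_mult ext_mult[symmetric] mult.left_commute)
  from this[of "\<lambda>c. mcoord c F"] show ?thesis
    unfolding F[symmetric] .
qed

text \<open>The substitution is linear over \<open>'e\<close> and its matrix has entries from
  \<open>'k\<close>, so it acts on each coordinate separately. Consequently the coordinates of an
  invariant over \<open>'e\<close> are invariants over \<open>'k\<close>.\<close>

lemma mcoord_lin_subst: "mcoord b (lin_subst (extmat A) F) = lin_subst A (mcoord b F)"
proof -
  obtain B where F: "F = (\<Sum>b\<in>B. mconst b * ext (mcoord b F))"
    using mcoord_expansion by blast
  have "mcoord b (lin_subst (extmat A) (\<Sum>c\<in>B. mconst c * ext (g c))) =
      lin_subst A (mcoord b (\<Sum>c\<in>B. mconst c * ext (g c)))" for g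
    by (simp add: lin_subst_sum lin_subst_mult mcoord_sum mcoord_mconst_mult ext_lin_subst[symmetric])
  from this[of "\<lambda>c. mcoord c F"] show ?thesis
    unfolding F[symmetric] .
qed

text \<open>If \<open>R\<close> is a subring of the polynomials over \<open>'k\<close> containing the constants, then
  \<open>base_change R\<close> is the subring generated by \<open>R\<close> and the constants of \<open>'e\<close>.\<close>

definition base_change :: "('k, 'n) mpoly set \<Rightarrow> ('e, 'n) mpoly set" where
  "base_change R = {F. \<forall>b. mcoord b F \<in> R}"

text \<open>Coordinates of a product are combinations of products of coordinates, whose coefficients
  are the structure constants \<open>coord a (b * c)\<close>; as constants these belong to
  \<open>R\<close>.\<close>

lemma base_change_mult:
  assumes zero: "0 \<in> R" and add: "\<And>f g. f \<in> R \<Longrightarrow> g \<in> R \<Longrightarrow> f + g \<in> R"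
    and mult: "\<And>f g. f \<in> R \<Longrightarrow> g \<in> R \<Longrightarrow> f * g \<in> R" and const: "range mconst \<subseteq> R"
    and F: "F \<in> base_change R" and H: "H \<in> base_change R"
  shows "F * H \<in> base_change R"
proof -
  obtain B where B: "F = (\<Sum>b\<in>B. mconst b * ext (mcoord b F))"
    using mcoord_expansion by blast
  obtain C where C: "H = (\<Sum>b\<in>C. mconst b * ext (mcoord b H))"
    using mcoord_expansion by blast
  have sum: "sum f A \<in> R" if "\<And>x. f x \<in> R" for f :: "'e \<Rightarrow> _" and A
    using that by (induction A rule: infinite_finite_induct) (auto intro: zero add)
  have "mcoord a (F * H) \<in> R" for a
  proof -
    have "F * H = (\<Sum>b\<in>B. \<Sum>c\<in>C. mconst (b * c) * ext (mcoord b F * mcoord c H))"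
      by (subst B, subst C) (simp add: sum_product mconst_mult ext_mult mult_ac)
    then have "mcoord a (F * H) = (\<Sum>b\<in>B. \<Sum>c\<in>C. mconst (coord a (b * c)) * (mcoord b F * mcoord c H))"
      by (simp add: mcoord_sum mcoord_mconst_mult)
    also have "\<dots> \<in> R"
      using const F H by (intro sum mult) (auto simp: base_change_def)
    finally show ?thesis .
  qed
  then show ?thesis
    by (simp add: base_change_def)
qed

end

section \<open>Generated fields and invariant fractions\<close>

lemma ring_of_type_algebra_simps [simp]:
  fixes x y :: "'a::field"
  shows "carrier (ring_of_type_algebra :: 'a ring) = UNIV"
    and "x \<oplus>\<^bsub>ring_of_type_algebra\<^esub> y = x + y"
    and "x \<otimes>\<^bsub>ring_of_type_algebra\<^esub> y = x * y"
    and "\<one>\<^bsub>ring_of_type_algebra\<^esub> = (1 :: 'a)"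
    and "\<zero>\<^bsub>ring_of_type_algebra\<^esub> = (0 :: 'a)"
  by (simp_all add: ring_of_type_algebra_def)

lemma ring_of_type_algebra_uminus [simp]:
  fixes x :: "'a::field"
  shows "\<ominus>\<^bsub>ring_of_type_algebra\<^esub> x = - x"
proof -
  interpret F: Ring.field "ring_of_type_algebra :: 'a ring"
    by (rule field_from_type_algebra)
  show ?thesis
    by (rule F.minus_equality) auto
qed

lemma ring_of_type_algebra_inv [simp]:
  fixes x :: "'a::field"
  assumes "x \<noteq> 0"
  shows "inv\<^bsub>ring_of_type_algebra\<^esub> x = inverse x"
proof -
  interpret F: Ring.field "ring_of_type_algebra :: 'a ring"
    by (rule field_from_type_algebra)
  show ?thesis
    by (rule F.comm_inv_char) (use assms in auto)
qed

text \<open>Minimality of the generated subfield, applied to the invariant fractions and later to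
  the quotients of polynomials of weight zero.\<close>

lemma adjoin_subset:
  assumes gen: "\<And>c. to_fract (mconst c) \<in> Y" "\<And>f. f \<in> S \<Longrightarrow> to_fract f \<in> Y"
    and add: "\<And>x y. x \<in> Y \<Longrightarrow> y \<in> Y \<Longrightarrow> x + y \<in> Y"
    and mult: "\<And>x y. x \<in> Y \<Longrightarrow> y \<in> Y \<Longrightarrow> x * y \<in> Y"
    and uminus: "\<And>x. x \<in> Y \<Longrightarrow> - x \<in> Y"
    and inv: "\<And>x. x \<in> Y \<Longrightarrow> x \<noteq> 0 \<Longrightarrow> inverse x \<in> Y"
  shows "adjoin S \<subseteq> Y"
proof
  fix q assume "q \<in> adjoin S"
  then show "q \<in> Y"
    unfolding adjoin_def
  proof (induction rule: generate_field.induct)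
    case one
    then show ?case using gen(1)[of 1] by simp
  qed (auto intro: assms)
qed

lemma adjoin_incl:
  shows adjoin_mconst: "to_fract (mconst c) \<in> adjoin S"
    and adjoin_base: "f \<in> S \<Longrightarrow> to_fract f \<in> adjoin S"
  by (auto simp: adjoin_def intro!: generate_field.incl)

lemma subfield_adjoin:
  fixes S :: "('k::field, 'n::{finite,linorder}) mpoly set"
  shows "subfield (adjoin S) ring_of_type_algebra"
proof -
  interpret F: Ring.field "ring_of_type_algebra :: ('k, 'n) mpoly fract ring"
    by (rule field_from_type_algebra)
  show ?thesis
    unfolding adjoin_def by (rule F.generate_field_is_subfield) simp
qed

lemma adjoin_closed:
  shows adjoin_add: "x \<in> adjoin S \<Longrightarrow> y \<in> adjoin S \<Longrightarrow> x + y \<in> adjoin S"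
    and adjoin_mult: "x \<in> adjoin S \<Longrightarrow> y \<in> adjoin S \<Longrightarrow> x * y \<in> adjoin S"
    and adjoin_inverse: "x \<in> adjoin S \<Longrightarrow> inverse x \<in> adjoin S"
proof -
  show "x \<in> adjoin S \<Longrightarrow> y \<in> adjoin S \<Longrightarrow> x + y \<in> adjoin S"
    "x \<in> adjoin S \<Longrightarrow> y \<in> adjoin S \<Longrightarrow> x * y \<in> adjoin S"
    unfolding adjoin_def
    using generate_field.eng_add[of x ring_of_type_algebra _ y] generate_field.eng_mult[of x ring_of_type_algebra _ y]
    by simp_all
  show "inverse x \<in> adjoin S" if "x \<in> adjoin S"
  proof (cases "x = 0")
    case True
    then show ?thesis using adjoin_mconst[of 0] by simp
  next
    case False
    then show ?thesis
      using that generate_field.m_inv[of x ring_of_type_algebra] by (simp add: adjoin_def)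
  qed
qed

lemma adjoin_divide: "x \<in> adjoin S \<Longrightarrow> y \<in> adjoin S \<Longrightarrow> x / y \<in> adjoin S"
  by (simp add: divide_inverse adjoin_mult adjoin_inverse)

lemma finite_dimension_refl:
  fixes K :: "'a::field set"
  assumes "subfield K ring_of_type_algebra"
  shows "ring.finite_dimension ring_of_type_algebra K K"
proof -
  interpret F: Ring.field "ring_of_type_algebra :: 'a ring"
    by (rule field_from_type_algebra)
  show ?thesis
    by (rule F.finite_dimensionI[OF F.dimension_one[OF assms]])
qed

lemma combine_eq_sum:
  fixes Ks Us :: "'a::field list"
  assumes "length Ks = length Us"
  shows "ring.combine ring_of_type_algebra Ks Us = (\<Sum>i<length Us. Ks ! i * Us ! i)"
proof -
  interpret F: Ring.field "ring_of_type_algebra :: 'a ring"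
    by (rule field_from_type_algebra)
  show ?thesis using assms
  proof (induction Ks Us rule: list_induct2)
    case (Cons k Ks u Us)
    then show ?case
      by (simp add: sum.lessThan_Suc_shift del: sum.lessThan_Suc)
  qed simp
qed

text \<open>The \<open>n + 1\<close> powers of \<open>x\<close> from exponent 0 to \<open>n\<close>
  are dependent in a space of dimension \<open>n\<close>.\<close>

lemma finite_dimension_imp_algebraic:
  fixes K E :: "'a::field set"
  assumes K: "subfield K ring_of_type_algebra"
    and fin: "ring.finite_dimension ring_of_type_algebra K E"
    and x: "\<And>j. x ^ j \<in> E"
  obtains n and c :: "nat \<Rightarrow> 'a" and j where "\<And>i. c i \<in> K" "(\<Sum>i<n. c i * x ^ i) = 0" "j < n" "c j \<noteq> 0"
proof -
  interpret F: Ring.field "ring_of_type_algebra :: 'a ring"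
    by (rule field_from_type_algebra)
  obtain n where n: "F.dimension n K E"
    using fin by blast
  define Us where "Us = map (\<lambda>j. x ^ j) [0..<Suc n]"
  have len: "length Us = Suc n" by (simp add: Us_def)
  have "\<not> F.independent K Us"
  proof
    assume "F.independent K Us"
    moreover have "set Us \<subseteq> E" using x by (auto simp: Us_def)
    ultimately have "length Us \<le> n"
      using F.independent_length_le_dimension[OF K n] by blast
    then show False by (simp add: len)
  qed
  then obtain Ks where Ks: "length Ks = length Us" "F.combine Ks Us = 0" "set Ks \<subseteq> K" "set Ks \<noteq> {0}"
    using F.dependent_imp_non_trivial_combine[OF K, of Us] by (metis subset_UNIV ring_of_type_algebra_simps(1,5))
  define c where "c = (\<lambda>i. if i < Suc n then Ks ! i else 0)"
  have zK: "0 \<in> K"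
    using subringE(2)[OF subfieldE(1)[OF K]] by simp
  \<comment> \<open>That \<open>set Ks\<close> differs from \<open>{0}\<close> still allows the
    empty list; the length excludes it, so some coefficient is nonzero.\<close>
  have "set Ks \<noteq> {}"
    using Ks(1) len by auto
  then have "\<not> set Ks \<subseteq> {0}"
    using Ks(4) by (simp add: subset_singleton_iff)
  then obtain k where "k \<in> set Ks" "k \<noteq> 0"
    by blast
  then obtain j where j: "j < Suc n" "c j \<noteq> 0"
    using Ks(1) by (auto simp: in_set_conv_nth c_def len)
  have "c i \<in> K" for i
    using Ks(1,3) zK by (auto simp: c_def len)
  moreover have "(\<Sum>i<Suc n. c i * x ^ i) = 0"
  proof -
    have "(\<Sum>i<Suc n. c i * x ^ i) = (\<Sum>i<length Us. Ks ! i * Us ! i)"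
      unfolding len by (intro sum.cong) (auto simp: c_def Us_def simp del: upt_Suc)
    also have "\<dots> = F.combine Ks Us"
      by (rule combine_eq_sum[symmetric, OF Ks(1)])
    finally show ?thesis by (simp add: Ks(2))
  qed
  ultimately show ?thesis
    using that j by blast
qed

section \<open>Invariant polynomials and invariant fractions\<close>

lemma rat_lin_subst_to_fract:
  assumes "invertible A"
  shows "rat_lin_subst A (to_fract f) = to_fract (lin_subst A f)"
  using rat_lin_subst_Fract[OF assms, of 1 f] lin_subst_mconst[of A 1] by (simp add: to_fract_def)

lemma rat_lin_subst_hom:
  assumes A: "invertible A"
  shows rat_lin_subst_add: "rat_lin_subst A (x + y) = rat_lin_subst A x + rat_lin_subst A y"
    and rat_lin_subst_mult: "rat_lin_subst A (x * y) = rat_lin_subst A x * rat_lin_subst A y"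
    and rat_lin_subst_uminus: "rat_lin_subst A (- x) = - rat_lin_subst A x"
    and rat_lin_subst_inverse: "rat_lin_subst A (inverse x) = inverse (rat_lin_subst A x)"
proof -
  obtain a b where x: "x = Fract a b" "b \<noteq> 0" by (cases x)
  obtain c d where y: "y = Fract c d" "d \<noteq> 0" by (cases y)
  have um: "lin_subst A (- f) = - lin_subst A f" for f
    using lin_subst_add[of A f "- f"] by (simp add: eq_neg_iff_add_eq_0 add.commute)
  note nz = x(2) y(2) lin_subst_eq_0_iff[OF A]
  show "rat_lin_subst A (x + y) = rat_lin_subst A x + rat_lin_subst A y"
    "rat_lin_subst A (x * y) = rat_lin_subst A x * rat_lin_subst A y"
    "rat_lin_subst A (- x) = - rat_lin_subst A x"
    by (simp_all add: x y nz rat_lin_subst_Fract[OF A] lin_subst_add lin_subst_mult um)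
  show "rat_lin_subst A (inverse x) = inverse (rat_lin_subst A x)"
  proof (cases "a = 0")
    case True
    then have "x = 0" by (simp add: x Zero_fract_def eq_fract)
    moreover have "rat_lin_subst A 0 = 0"
      using rat_lin_subst_to_fract[OF A, of 0] by simp
    ultimately show ?thesis by simp
  next
    case False
    then show ?thesis
      by (simp add: x nz rat_lin_subst_Fract[OF A])
  qed
qed

definition poly_invariants :: "('g, 'b) monoid_scheme \<Rightarrow> ('g \<Rightarrow> ('k::field, 'n::finite) sqmat) \<Rightarrow> ('k, 'n) mpoly set" where
  "poly_invariants G \<rho> = {f. \<forall>g\<in>carrier G. lin_subst (\<rho> g) f = f}"

lemma poly_invariants_le_eq:
  assumes "group G"
  shows "poly_invariants_le G \<rho> d = {f \<in> poly_invariants G \<rho>. total_degree f \<le> d}"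
proof -
  interpret group G by fact
  have "(\<forall>g\<in>carrier G. lin_subst (\<rho> (inv\<^bsub>G\<^esub> g)) f = f) \<longleftrightarrow> (\<forall>g\<in>carrier G. lin_subst (\<rho> g) f = f)" for f
    by (metis inv_closed inv_inv)
  then show ?thesis
    by (auto simp: poly_invariants_le_def poly_invariants_def)
qed

lemma rat_invariants_eq:
  assumes "group G"
  shows "rat_invariants G \<rho> = {q. \<forall>g\<in>carrier G. rat_lin_subst (\<rho> g) q = q}"
proof -
  interpret group G by fact
  have "(\<forall>g\<in>carrier G. rat_lin_subst (\<rho> (inv\<^bsub>G\<^esub> g)) q = q) \<longleftrightarrow> (\<forall>g\<in>carrier G. rat_lin_subst (\<rho> g) q = q)" for q
    by (metis inv_closed inv_inv)
  then show ?thesis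
    by (auto simp: rat_invariants_def)
qed

lemma hom_GL:
  assumes "\<rho> \<in> hom G GL"
  shows "g \<in> carrier G \<Longrightarrow> invertible (\<rho> g)"
    and "g \<in> carrier G \<Longrightarrow> h \<in> carrier G \<Longrightarrow> \<rho> (g \<otimes>\<^bsub>G\<^esub> h) = \<rho> g ** \<rho> h"
  using assms by (auto simp: hom_def GL_def)

lemma hom_GL_one:
  assumes "group G" and \<rho>: "\<rho> \<in> hom G GL"
  shows "\<rho> \<one>\<^bsub>G\<^esub> = mat 1"
proof -
  interpret group G by fact
  have "\<rho> \<one>\<^bsub>G\<^esub> ** \<rho> \<one>\<^bsub>G\<^esub> = \<rho> \<one>\<^bsub>G\<^esub>"
    using hom_GL(2)[OF \<rho>, of "\<one>\<^bsub>G\<^esub>" "\<one>\<^bsub>G\<^esub>"] by simp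
  moreover obtain C where "C ** \<rho> \<one>\<^bsub>G\<^esub> = mat 1"
    using hom_GL(1)[OF \<rho>, of "\<one>\<^bsub>G\<^esub>"] by (auto simp: invertible_def)
  ultimately show ?thesis
    by (metis matrix_mul_assoc matrix_mul_lid)
qed

lemma adjoin_invariants_subset:
  assumes G: "group G" and \<rho>: "\<rho> \<in> hom G GL"
  shows "adjoin (poly_invariants_le G \<rho> d) \<subseteq> rat_invariants G \<rho>"
  unfolding rat_invariants_eq[OF G] poly_invariants_le_eq[OF G]
  by (rule adjoin_subset)
    (auto simp: rat_lin_subst_to_fract hom_GL[OF \<rho>] rat_lin_subst_hom poly_invariants_def)

text \<open>The fraction is expanded by the other conjugates of its denominator. The new denominator
  is a product over the whole group, which right translation only permutes; being invariant, it
  forces the numerator to be invariant too.\<close>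

lemma rat_invariants_subset:
  fixes \<rho> :: "'g \<Rightarrow> ('k::field, 'n::{finite,linorder}) sqmat"
  assumes G: "group G" and fin: "finite (carrier G)" and \<rho>: "\<rho> \<in> hom G GL"
    and q: "q \<in> rat_invariants G \<rho>"
  obtains a b where "a \<in> poly_invariants G \<rho>" "b \<in> poly_invariants G \<rho>" "b \<noteq> 0"
    "q = to_fract a / to_fract b"
proof -
  interpret group G by (rule G)
  obtain a b where ab: "q = Fract a b" "b \<noteq> 0" by (cases q)
  define b' where "b' = (\<Prod>g\<in>carrier G. lin_subst (\<rho> g) b)"
  define a' where "a' = a * (\<Prod>g\<in>carrier G - {\<one>\<^bsub>G\<^esub>}. lin_subst (\<rho> g) b)"
  have "lin_subst (\<rho> \<one>\<^bsub>G\<^esub>) f = f" for f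
    by (simp add: hom_GL_one[OF G \<rho>])
  then have b'_eq: "b' = b * (\<Prod>g\<in>carrier G - {\<one>\<^bsub>G\<^esub>}. lin_subst (\<rho> g) b)"
    unfolding b'_def by (subst prod.remove[of _ "\<one>\<^bsub>G\<^esub>"]) (auto simp: fin)
  have b'0: "b' \<noteq> 0"
    by (auto simp: b'_def fin lin_subst_eq_0_iff hom_GL[OF \<rho>] ab)
  have q: "q = Fract a' b'"
    unfolding ab using b'0 ab(2) by (simp add: eq_fract b'_eq a'_def mult_ac)
  have inv_b: "lin_subst (\<rho> h) b' = b'" if h: "h \<in> carrier G" for h
  proof -
    have "lin_subst (\<rho> h) b' = (\<Prod>g\<in>carrier G. lin_subst (\<rho> (g \<otimes>\<^bsub>G\<^esub> h)) b)"
      using h by (simp add: b'_def lin_subst_prod lin_subst_lin_subst hom_GL[OF \<rho>])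
    also have "\<dots> = b'"
      unfolding b'_def
      by (rule prod.reindex_bij_witness[of _ "\<lambda>g. g \<otimes>\<^bsub>G\<^esub> inv\<^bsub>G\<^esub> h" "\<lambda>g. g \<otimes>\<^bsub>G\<^esub> h"])
        (use h in \<open>auto simp: m_assoc\<close>)
    finally show ?thesis .
  qed
  have "lin_subst (\<rho> h) a' = a'" if h: "h \<in> carrier G" for h
  proof -
    have "rat_lin_subst (\<rho> h) q = q"
      using assms(4) h by (auto simp: rat_invariants_eq[OF G])
    then have "Fract (lin_subst (\<rho> h) a') b' = Fract a' b'"
      using rat_lin_subst_Fract[OF hom_GL(1)[OF \<rho> h] b'0, of a'] by (simp add: q inv_b[OF h])
    then show ?thesis
      using b'0 by (simp add: eq_fract)
  qed
  then show ?thesis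
    using that[of a' b'] inv_b b'0 q by (simp add: poly_invariants_def Fract_conv_to_fract)
qed

section \<open>Representations with two nontrivial characters\<close>

text \<open>The columns of \<open>P\<close> form a joint eigenbasis over \<open>'e\<close>;
  \<open>I\<close> and \<open>J\<close> index the columns with characters
  \<open>\<chi>\<^sub>1\<close> and \<open>\<chi>\<^sub>2\<close>, and the remaining columns are
  fixed. By \<open>roots\<close> the power with exponent \<open>order G\<close> of each diagonal
  coordinate is invariant.\<close>

locale two_character_rep = field_embedding \<phi>
  for \<phi> :: "'k::field \<Rightarrow> 'e::field" +
  fixes G :: "('g, 'b) monoid_scheme" and \<rho> :: "'g \<Rightarrow> ('k, 'n::{finite,linorder}) sqmat"
    and P P' :: "('e, 'n) sqmat" and \<chi>\<^sub>1 \<chi>\<^sub>2 :: "'g \<Rightarrow> 'e" and I J :: "'n set"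
  assumes group: "group G" and fin: "finite (carrier G)" and hom: "\<rho> \<in> hom G GL"
    and PP': "P ** P' = mat 1" "P' ** P = mat 1"
    and diagonal: "g \<in> carrier G \<Longrightarrow> extmat (\<rho> g) ** P =
      P ** (\<chi> i j. if i = j then if i \<in> I then \<chi>\<^sub>1 g else if i \<in> J then \<chi>\<^sub>2 g else 1 else 0)"
    and disjoint: "I \<inter> J = {}" and nonempty: "I \<noteq> {}" "J \<noteq> {}"
    and roots: "g \<in> carrier G \<Longrightarrow> \<chi>\<^sub>1 g ^ order G = 1" "g \<in> carrier G \<Longrightarrow> \<chi>\<^sub>2 g ^ order G = 1"
begin

lemma order_pos: "order G > 0"
  using group fin by (simp add: group.is_monoid monoid.order_gt_0_iff_finite)

lemma characters_nonzero: "g \<in> carrier G \<Longrightarrow> \<chi>\<^sub>1 g \<noteq> 0" "g \<in> carrier G \<Longrightarrow> \<chi>\<^sub>2 g \<noteq> 0"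
  using roots[of g] order_pos by (auto simp: power_0_left)

text \<open>The lattice of relations between the two characters; integer exponents make it closed
  under differences.\<close>

definition relation :: "int \<Rightarrow> int \<Rightarrow> bool" where
  "relation p q \<longleftrightarrow> (\<forall>g\<in>carrier G. \<chi>\<^sub>1 g powi p * \<chi>\<^sub>2 g powi q = 1)"

lemma relation_diff: "relation p q \<Longrightarrow> relation r s \<Longrightarrow> relation (p - r) (q - s)"
  by (simp add: relation_def power_int_diff characters_nonzero)

definition monomial :: "('n \<Rightarrow>\<^sub>0 nat) \<Rightarrow> ('e, 'n) mpoly" where
  "monomial m = Poly_Mapping.single m 1"

lemma keys_monomial [simp]: "Poly_Mapping.keys (monomial m) = {m}"
  by (simp add: monomial_def)

lemma lin_subst_inverse [simp]:
  "lin_subst P (lin_subst P' F) = F" "lin_subst P' (lin_subst P F) = F"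
  by (simp_all add: lin_subst_lin_subst PP')

lemma lin_subst_P_eq_0_iff [simp]: "lin_subst P F = 0 \<longleftrightarrow> F = 0" "lin_subst P' F = 0 \<longleftrightarrow> F = 0"
  by (metis lin_subst_inverse lin_subst_zero)+

definition ext_invariants :: "('e, 'n) mpoly set" where
  "ext_invariants = {F. \<forall>g\<in>carrier G. lin_subst (extmat (\<rho> g)) F = F}"

text \<open>In the coordinates given by \<open>P\<close> a group element multiplies the coefficient
  at \<open>m\<close> by a product of powers of the two characters, so invariance is tested on each
  monomial separately.\<close>

lemma ext_invariants_iff:
  "F \<in> ext_invariants \<longleftrightarrow>
    (\<forall>m\<in>Poly_Mapping.keys (lin_subst P F). relation (int (deg_on I m)) (int (deg_on J m)))"
proof -
  let ?D = "\<lambda>g. (\<chi> i j. if i = j then if i \<in> I then \<chi>\<^sub>1 g else if i \<in> J then \<chi>\<^sub>2 g else 1 else 0) :: ('e, 'n) sqmat"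
  let ?H = "lin_subst P F"
  have "lin_subst (extmat (\<rho> g)) F = F \<longleftrightarrow> (\<forall>m\<in>Poly_Mapping.keys ?H. \<chi>\<^sub>1 g ^ deg_on I m * \<chi>\<^sub>2 g ^ deg_on J m = 1)"
    if g: "g \<in> carrier G" for g
  proof -
    have lookup: "Poly_Mapping.lookup (lin_subst (?D g) ?H) m =
      \<chi>\<^sub>1 g ^ deg_on I m * \<chi>\<^sub>2 g ^ deg_on J m * Poly_Mapping.lookup ?H m" for m
    proof -
      have "(\<Prod>i\<in>UNIV. (if i \<in> I then \<chi>\<^sub>1 g else if i \<in> J then \<chi>\<^sub>2 g else 1) ^ Poly_Mapping.lookup m i) =
        (\<Prod>i\<in>UNIV. if i \<in> I then \<chi>\<^sub>1 g ^ Poly_Mapping.lookup m i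
          else if i \<in> J then \<chi>\<^sub>2 g ^ Poly_Mapping.lookup m i else 1)"
        by (intro prod.cong) auto
      also have "\<dots> = \<chi>\<^sub>1 g ^ deg_on I m * \<chi>\<^sub>2 g ^ deg_on J m"
        by (subst prod_if_disjoint[OF disjoint]) (simp add: deg_on_def power_sum)
      finally show ?thesis
        by (subst lookup_lin_subst_diagonal[where c = "\<lambda>i. if i \<in> I then \<chi>\<^sub>1 g else if i \<in> J then \<chi>\<^sub>2 g else 1"])
          simp_all
    qed
    have "lin_subst (extmat (\<rho> g)) F = F \<longleftrightarrow> lin_subst P (lin_subst (extmat (\<rho> g)) F) = ?H"
      by (metis lin_subst_inverse(2))
    also have "lin_subst P (lin_subst (extmat (\<rho> g)) F) = lin_subst (?D g) ?H"
      by (simp add: lin_subst_lin_subst diagonal[OF g])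
    also have "lin_subst (?D g) ?H = ?H \<longleftrightarrow>
      (\<forall>m. Poly_Mapping.lookup (lin_subst (?D g) ?H) m = Poly_Mapping.lookup ?H m)"
      by (auto intro: poly_mapping_eqI)
    finally show ?thesis
      by (auto simp: in_keys_iff lookup)
  qed
  then show ?thesis
    by (auto simp: ext_invariants_def relation_def)
qed

lemma monomial_in_ext_invariants:
  "relation (int (deg_on I m)) (int (deg_on J m)) \<Longrightarrow> lin_subst P' (monomial m) \<in> ext_invariants"
  by (simp add: ext_invariants_iff)

lemma mcoord_in_invariants: "F \<in> ext_invariants \<Longrightarrow> mcoord b F \<in> poly_invariants G \<rho>"
  by (simp add: poly_invariants_def ext_invariants_def flip: mcoord_lin_subst)

lemma ext_in_ext_invariants: "f \<in> poly_invariants G \<rho> \<Longrightarrow> ext f \<in> ext_invariants"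
  by (simp add: poly_invariants_def ext_invariants_def flip: ext_lin_subst)

text \<open>Over \<open>'e\<close>, the monomials that are quotients of elements of \<open>T\<close>
  have exponents satisfying \<open>saturated_exponents\<close>, so they include all invariant
  monomials and \<open>Q\<close> contains the transform of \<open>ext f\<close>. A coordinate
  functional then brings the resulting quotient down to \<open>'k\<close>.\<close>

lemma invariant_in_adjoin:
  assumes rank: "relation p0 q0" "0 \<le> p0" "0 \<le> q0" "p0 + q0 \<le> int d"
      "relation r0 s0" "0 \<le> r0" "0 \<le> s0" "r0 + s0 \<le> int d" "p0 * s0 \<noteq> q0 * r0"
    and f: "f \<in> poly_invariants G \<rho>"
  shows "to_fract f \<in> adjoin (poly_invariants_le G \<rho> d)"
proof -
  define K where "K = adjoin (poly_invariants_le G \<rho> d)"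
  define R where "R = {a. to_fract a \<in> K}"
  define T where "T = base_change R"
  have const: "to_fract (mconst c) \<in> K" for c
    by (simp add: K_def adjoin_mconst)
  have R0: "0 \<in> R" using const[of 0] by (simp add: R_def)
  have T_add: "F + H \<in> T" if "F \<in> T" "H \<in> T" for F H
    using that by (auto simp: T_def base_change_def R_def K_def mcoord_add adjoin_add)
  have T_mult: "F * H \<in> T" if "F \<in> T" "H \<in> T" for F H
    unfolding T_def
    by (rule base_change_mult) (use that const R0 in \<open>auto simp: T_def R_def K_def adjoin_add adjoin_mult\<close>)
  have T_const: "mconst c \<in> T" for c
    using mcoord_mconst_mult[of _ c "1 :: ('k, 'n) mpoly"] const by (simp add: T_def base_change_def R_def)
  have T_1: "1 \<in> T" and T_0: "0 \<in> T" using T_const[of 1] T_const[of 0] by simp_all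
  \<comment> \<open>Polynomials in diagonal coordinates that are quotients of elements of
    \<open>T\<close>, expressed through a common multiple so that no fractions over
    \<open>'e\<close> occur.\<close>
  define Q where "Q = {F. \<exists>B\<in>T. B \<noteq> 0 \<and> lin_subst P' F * B \<in> T}"
  have Q_I: "F \<in> Q" if "lin_subst P' F \<in> T" for F
    using that T_1 by (auto simp: Q_def intro!: bexI[of _ 1])
  have Q_add: "F + H \<in> Q" if F: "F \<in> Q" and H: "H \<in> Q" for F H
  proof -
    obtain B where B: "B \<in> T" "B \<noteq> 0" "lin_subst P' F * B \<in> T" using F by (auto simp: Q_def)
    obtain C where C: "C \<in> T" "C \<noteq> 0" "lin_subst P' H * C \<in> T" using H by (auto simp: Q_def)
    have "lin_subst P' (F + H) * (B * C) = lin_subst P' F * B * C + lin_subst P' H * C * B"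
      by (simp add: lin_subst_add algebra_simps)
    then have "lin_subst P' (F + H) * (B * C) \<in> T"
      using T_add[OF T_mult[OF B(3) C(1)] T_mult[OF C(3) B(1)]] by (simp only:)
    then show ?thesis
      using B C T_mult by (auto simp: Q_def intro!: bexI[of _ "B * C"])
  qed
  have Q_mult: "F * H \<in> Q" if F: "F \<in> Q" and H: "H \<in> Q" for F H
  proof -
    obtain B where B: "B \<in> T" "B \<noteq> 0" "lin_subst P' F * B \<in> T" using F by (auto simp: Q_def)
    obtain C where C: "C \<in> T" "C \<noteq> 0" "lin_subst P' H * C \<in> T" using H by (auto simp: Q_def)
    have "lin_subst P' (F * H) * (B * C) = (lin_subst P' F * B) * (lin_subst P' H * C)"
      by (simp add: lin_subst_mult mult_ac)
    then have "lin_subst P' (F * H) * (B * C) \<in> T"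
      using T_mult[OF B(3) C(3)] by (simp only:)
    then show ?thesis
      using B C T_mult by (auto simp: Q_def intro!: bexI[of _ "B * C"])
  qed
  have Q_divide: "F \<in> Q" if FH: "F * H \<in> Q" and H: "H \<in> Q" "H \<noteq> 0" for F H
  proof -
    obtain B where B: "B \<in> T" "B \<noteq> 0" "lin_subst P' (F * H) * B \<in> T" using FH by (auto simp: Q_def)
    obtain C where C: "C \<in> T" "C \<noteq> 0" "lin_subst P' H * C \<in> T" using H by (auto simp: Q_def)
    \<comment> \<open>The new denominator contains the numerator of \<open>H\<close>, which is
      nonzero because \<open>H\<close> is.\<close>
    let ?B = "(lin_subst P' H * C) * B"
    have "lin_subst P' F * ?B = (lin_subst P' (F * H) * B) * C"
      by (simp add: lin_subst_mult mult_ac)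
    then have "lin_subst P' F * ?B \<in> T"
      using T_mult[OF B(3) C(1)] by (simp only:)
    moreover have "?B \<in> T" "?B \<noteq> 0"
      using B C H by (simp_all add: T_mult)
    ultimately show ?thesis
      unfolding Q_def by blast
  qed
  have mono: "monomial m \<in> Q" if m: "relation (int (deg_on I m)) (int (deg_on J m))" for m
  proof -
    have mono_add: "monomial (m + n) = monomial m * monomial n" for m n
      by (simp add: monomial_def mult_single)
    obtain i0 j0 where ij: "i0 \<in> I" "j0 \<in> J"
      using nonempty by blast
    have "m \<in> {m. monomial m \<in> Q}"
    proof (rule saturated_exponents[where I = I and J = J and L = relation and d = d and ?i0.0 = i0 and ?j0.0 = j0
          and ?p0.0 = p0 and ?q0.0 = q0 and ?r0.0 = r0 and ?s0.0 = s0])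
      fix m n assume "m + n \<in> {m. monomial m \<in> Q}" "n \<in> {m. monomial m \<in> Q}"
      moreover have "monomial n \<noteq> 0"
        using keys_monomial[of n] by (metis insert_not_empty keys_zero)
      ultimately show "m \<in> {m. monomial m \<in> Q}"
        using Q_divide by (simp add: mono_add)
    next
      \<comment> \<open>The coordinates of an invariant polynomial of degree at most
        \<open>d\<close> over \<open>'e\<close> are invariants over \<open>'k\<close> of degree at
        most \<open>d\<close>, hence generators of \<open>K\<close>.\<close>
      fix m assume m: "relation (int (deg_on I m)) (int (deg_on J m))" "deg_on UNIV m \<le> d"
      have "total_degree (lin_subst P' (monomial m)) \<le> d"
        using m(2) by (intro order_trans[OF total_degree_lin_subst_le]) (simp add: total_degree_le_iff deg_on_def)
      then have "mcoord b (lin_subst P' (monomial m)) \<in> poly_invariants_le G \<rho> d" for b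
        using mcoord_in_invariants[OF monomial_in_ext_invariants[OF m(1)]]
        by (auto simp: poly_invariants_le_eq[OF group] intro: order_trans[OF total_degree_mcoord_le])
      then have "lin_subst P' (monomial m) \<in> T"
        by (simp add: T_def base_change_def R_def K_def adjoin_base)
      then show "m \<in> {m. monomial m \<in> Q}"
        by (simp add: Q_I)
    qed (use disjoint ij relation_diff rank m Q_mult in \<open>simp_all add: mono_add\<close>)
    then show ?thesis by simp
  qed
  let ?H = "lin_subst P (ext f)"
  have "(\<Sum>m\<in>M. mconst (Poly_Mapping.lookup ?H m) * monomial m) \<in> Q"
    if "M \<subseteq> Poly_Mapping.keys ?H" for M
    using finite_subset[OF that finite_keys] that
  proof (induction M rule: finite_induct)
    case empty
    then show ?case by (simp add: Q_I T_0)
  next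
    case (insert m M)
    then have "relation (int (deg_on I m)) (int (deg_on J m))"
      using ext_in_ext_invariants[OF f] by (simp add: ext_invariants_iff)
    then have "mconst (Poly_Mapping.lookup ?H m) * monomial m \<in> Q"
      by (intro Q_mult mono) (simp add: Q_I T_const)
    then show ?case
      using insert by (auto intro: Q_add)
  qed
  also have "(\<Sum>m\<in>Poly_Mapping.keys ?H. mconst (Poly_Mapping.lookup ?H m) * monomial m) = ?H"
    using mpoly_decomp[of ?H] by (simp add: mconst_def monomial_def mult_single)
  finally have "?H \<in> Q" by simp
  then obtain B where B: "B \<in> T" "B \<noteq> 0" "ext f * B \<in> T"
    by (auto simp: Q_def)
  \<comment> \<open>Taking this coordinate of \<open>ext f * B\<close> gives
    \<open>f * mcoord b B\<close>, so \<open>f\<close> is a quotient of two elements of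
    \<open>K\<close>.\<close>
  obtain b where b: "mcoord b B \<noteq> 0"
    using mcoord_eq_0 B(2) by blast
  have "to_fract (f * mcoord b B) \<in> K" "to_fract (mcoord b B) \<in> K"
    using B by (auto simp: T_def base_change_def R_def mcoord_ext_mult)
  then have "to_fract (f * mcoord b B) / to_fract (mcoord b B) \<in> K"
    unfolding K_def by (rule adjoin_divide)
  then show ?thesis
    using b by (simp add: K_def)
qed

section \<open>Low-degree invariants that do not span the plane\<close>

lemma weight_eq:
  "weight (\<lambda>i. if i \<in> I then s else if i \<in> J then t else 0) m = s * int (deg_on I m) + t * int (deg_on J m)"
proof -
  have "weight (\<lambda>i. if i \<in> I then s else if i \<in> J then t else 0) m =
    (\<Sum>i\<in>UNIV. if i \<in> I then s * int (Poly_Mapping.lookup m i)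
      else if i \<in> J then t * int (Poly_Mapping.lookup m i) else 0)"
    unfolding weight_def by (intro sum.cong) auto
  then show ?thesis
    by (simp add: sum_if_disjoint[OF disjoint] deg_on_def sum_distrib_left)
qed

text \<open>The functional \<open>(s, t)\<close> defines a grading in diagonal coordinates. The
  field generated in degree at most \<open>d\<close> consists of quotients of polynomials of weight
  zero, whereas some invariant \<open>f\<close> is not of weight zero. In a finite extension
  \<open>f\<close> would be algebraic, contradicting \<open>weight_0_if_algebraic\<close>.\<close>

lemma infinite_dimension_if_deficient:
  assumes st: "s \<noteq> 0 \<or> t \<noteq> 0"
    and orth: "\<And>p q. relation p q \<Longrightarrow> 0 \<le> p \<Longrightarrow> 0 \<le> q \<Longrightarrow> p + q \<le> int d \<Longrightarrow> s * p + t * q = 0"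
  shows "\<not> ring.finite_dimension ring_of_type_algebra (adjoin (poly_invariants_le G \<rho> d)) (rat_invariants G \<rho>)"
proof
  let ?K = "adjoin (poly_invariants_le G \<rho> d)"
  assume findim: "ring.finite_dimension ring_of_type_algebra ?K (rat_invariants G \<rho>)"
  define w where "w = (\<lambda>i. if i \<in> I then s else if i \<in> J then t else 0)"
  define E where "E = {F :: ('e, 'n) mpoly. \<forall>m\<in>Poly_Mapping.keys F. weight w m = 0}"
  define W where "W = {f. lin_subst P (ext f) \<in> E}"
  have E_add: "F + H \<in> E" if "F \<in> E" "H \<in> E" for F H
    using that Poly_Mapping.keys_add[of F H] by (auto simp: E_def)
  have E_mult: "F * H \<in> E" if "F \<in> E" "H \<in> E" for F H
    using that keys_mult[of F H] by (fastforce simp: E_def weight_add)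
  have E_const: "mconst c \<in> E" for c
    by (auto simp: E_def mconst_def weight_def split: if_splits)
  have W_add: "f + h \<in> W" if "f \<in> W" "h \<in> W" for f h
    using that by (simp add: W_def ext_add lin_subst_add E_add)
  have W_mult: "f * h \<in> W" if "f \<in> W" "h \<in> W" for f h
    using that by (simp add: W_def ext_mult lin_subst_mult E_mult)
  have W_const: "mconst c \<in> W" for c
    by (simp add: W_def E_const)
  have W_uminus: "- f \<in> W" if "f \<in> W" for f
  proof -
    have "- f = mconst (- 1) * f"
      by (intro poly_mapping_eqI) (simp add: lookup_mconst_mult)
    then show ?thesis using W_mult[OF W_const that] by simp
  qed
  have W_1: "1 \<in> W" using W_const[of 1] by simp
  have W_prod: "prod f A \<in> W" if "\<And>i. f i \<in> W" for f and A :: "nat set"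
    using that by (induction A rule: infinite_finite_induct) (auto intro: W_1 W_mult)

  have "?K \<subseteq> {to_fract a / to_fract b | a b. a \<in> W \<and> b \<in> W \<and> b \<noteq> 0}" (is "_ \<subseteq> ?F")
  proof (rule adjoin_subset)
    fix c
    show "to_fract (mconst c) \<in> ?F"
      by (rule CollectI, rule exI[of _ "mconst c"], rule exI[of _ 1]) (simp add: W_const W_1)
  next
    fix f assume f: "f \<in> poly_invariants_le G \<rho> d"
    have "lin_subst P (ext f) \<in> E"
      unfolding E_def
    proof safe
      fix m assume m: "m \<in> Poly_Mapping.keys (lin_subst P (ext f))"
      have "total_degree (lin_subst P (ext f)) \<le> d"
        using f by (intro order_trans[OF total_degree_lin_subst_le]) (simp add: poly_invariants_le_eq[OF group])
      then have "deg_on UNIV m \<le> d"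
        using m by (simp add: total_degree_le_iff deg_on_def)
      moreover have "deg_on I m + deg_on J m \<le> deg_on UNIV m"
        unfolding deg_on_def by (subst sum.union_disjoint[symmetric]) (use disjoint in \<open>auto intro!: sum_mono2\<close>)
      moreover have "relation (int (deg_on I m)) (int (deg_on J m))"
        using f ext_in_ext_invariants[of f] m by (auto simp: poly_invariants_le_eq[OF group] ext_invariants_iff)
      ultimately show "weight w m = 0"
        unfolding w_def weight_eq by (intro orth) auto
    qed
    then show "to_fract f \<in> ?F"
      by (intro CollectI exI[of _ f] exI[of _ 1]) (simp add: W_1, simp add: W_def)
  next
    fix x y assume "x \<in> ?F" "y \<in> ?F"
    then obtain a b c e where x: "x = to_fract a / to_fract b" "a \<in> W" "b \<in> W" "b \<noteq> 0"
      and y: "y = to_fract c / to_fract e" "c \<in> W" "e \<in> W" "e \<noteq> 0"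
      by blast
    show "x + y \<in> ?F"
      using x y W_add W_mult
      by (intro CollectI exI[of _ "a * e + c * b"] exI[of _ "b * e"]) (simp add: field_simps)
    show "x * y \<in> ?F"
      using x y W_mult by (intro CollectI exI[of _ "a * c"] exI[of _ "b * e"]) simp
  next
    fix x assume "x \<in> ?F"
    then obtain a b where x: "x = to_fract a / to_fract b" "a \<in> W" "b \<in> W" "b \<noteq> 0"
      by blast
    show "- x \<in> ?F"
      using x W_uminus by (intro CollectI exI[of _ "- a"] exI[of _ b]) simp
    show "inverse x \<in> ?F" if "x \<noteq> 0"
      using x that by (intro CollectI exI[of _ b] exI[of _ a]) auto
  qed
  then have K_W: "\<exists>a b. x = to_fract a / to_fract b \<and> a \<in> W \<and> b \<in> W \<and> b \<noteq> 0" if "x \<in> ?K" for x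
    using that by blast

  obtain f where f: "f \<in> poly_invariants G \<rho>" "f \<notin> W"
  proof -
    obtain i0 j0 where ij: "i0 \<in> I" "j0 \<in> J" "i0 \<notin> J" "j0 \<notin> I"
      using nonempty disjoint by blast
    \<comment> \<open>A diagonal coordinate of nonzero weight; its power with exponent
      \<open>order G\<close> is an invariant monomial.\<close>
    define i where "i = (if s \<noteq> 0 then i0 else j0)"
    define m where "m = Poly_Mapping.single i (order G)"
    have "relation (int (deg_on I m)) (int (deg_on J m))"
      using roots by (simp add: m_def deg_on_single relation_def)
    then have inv: "lin_subst P' (monomial m) \<in> ext_invariants"
      by (rule monomial_in_ext_invariants)
    have wm: "weight w m \<noteq> 0"
      using st ij order_pos by (auto simp: w_def weight_eq m_def deg_on_single i_def)
    obtain B where B: "lin_subst P' (monomial m) = (\<Sum>b\<in>B. mconst b * ext (mcoord b (lin_subst P' (monomial m))))"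
      using mcoord_expansion by blast
    \<comment> \<open>The monomial is a combination over \<open>'e\<close> of its coordinates, so if
      all of these had weight zero it would have weight zero as well.\<close>
    have "\<exists>b. mcoord b (lin_subst P' (monomial m)) \<notin> W"
    proof (rule ccontr)
      assume "\<not> ?thesis"
      then have "mconst b * lin_subst P (ext (mcoord b (lin_subst P' (monomial m)))) \<in> E" for b
        by (auto intro!: E_mult E_const simp: W_def)
      then have "(\<Sum>b\<in>B. mconst b * lin_subst P (ext (mcoord b (lin_subst P' (monomial m))))) \<in> E"
        using E_const[of 0] by (induction B rule: infinite_finite_induct) (auto intro: E_add)
      also have "(\<Sum>b\<in>B. mconst b * lin_subst P (ext (mcoord b (lin_subst P' (monomial m))))) =
        lin_subst P (\<Sum>b\<in>B. mconst b * ext (mcoord b (lin_subst P' (monomial m))))"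
        by (simp add: lin_subst_sum lin_subst_mult)
      also have "\<dots> = monomial m"
        by (subst B[symmetric]) simp
      finally show False
        using wm by (simp add: E_def)
    qed
    then show ?thesis
      using that mcoord_in_invariants[OF inv] by blast
  qed

  have pow: "to_fract f ^ j \<in> rat_invariants G \<rho>" for j
  proof -
    have "f ^ j \<in> poly_invariants G \<rho>"
      using f by (simp add: poly_invariants_def lin_subst_power)
    moreover have "to_fract f ^ j = to_fract (f ^ j)"
      by (induction j) auto
    ultimately show ?thesis
      by (simp add: rat_invariants_eq[OF group] rat_lin_subst_to_fract hom_GL[OF hom] poly_invariants_def)
  qed
  obtain n j and c :: "nat \<Rightarrow> ('k, 'n) mpoly fract" where c: "\<And>i. c i \<in> ?K" "(\<Sum>i<n. c i * to_fract f ^ i) = 0" "j < n" "c j \<noteq> 0"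
    by (rule finite_dimension_imp_algebraic[OF subfield_adjoin findim pow]) (rule that)
  have "\<forall>i. \<exists>a b. c i = to_fract a / to_fract b \<and> a \<in> W \<and> b \<in> W \<and> b \<noteq> 0"
    using K_W[OF c(1)] by blast
  then obtain a b where ab: "\<And>i. c i = to_fract (a i) / to_fract (b i)" "\<And>i. a i \<in> W" "\<And>i. b i \<in> W" "\<And>i. b i \<noteq> 0"
    by (auto simp: choice_iff)
  \<comment> \<open>Clears denominators: \<open>A i\<close> is \<open>c i\<close> times the product
    of all \<open>b l\<close> with \<open>l < n\<close>.\<close>
  define A where "A = (\<lambda>i. a i * (\<Prod>l\<in>{..<n} - {i}. b l))"
  have A: "to_fract (A i) = c i * to_fract (\<Prod>l<n. b l)" if "i < n" for i
    using that ab(4)[of i] by (simp add: A_def ab(1) prod.remove[of "{..<n}" i])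
  have "to_fract (\<Sum>i<n. A i * f ^ i) = to_fract (\<Prod>l<n. b l) * (\<Sum>i<n. c i * to_fract f ^ i)"
  proof -
    have "to_fract (f ^ i) = to_fract f ^ i" for i
      by (induction i) auto
    then show ?thesis
      by (simp add: sum_distrib_left A mult_ac)
  qed
  then have "(\<Sum>i<n. A i * f ^ i) = 0"
    by (simp only: c(2) mult_zero_right to_fract_eq_0_iff)
  then have "lin_subst P (ext (\<Sum>i<n. A i * f ^ i)) = 0"
    by simp
  then have root: "(\<Sum>i<n. lin_subst P (ext (A i)) * lin_subst P (ext f) ^ i) = 0"
    by (simp add: ext_sum ext_mult ext_power lin_subst_sum lin_subst_mult lin_subst_power)
  have A_W: "A i \<in> W" for i
    unfolding A_def using ab by (intro W_mult W_prod) auto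
  have "A j \<noteq> 0"
    using A[OF c(3)] c(4) ab(4) by (metis (no_types, lifting) finite_lessThan mult_eq_0_iff prod_zero_iff to_fract_eq_0_iff)
  then have nz: "lin_subst P (ext (A j)) \<noteq> 0"
    by simp
  \<comment> \<open>In diagonal coordinates \<open>f\<close> is a root of a nontrivial equation with
    coefficients of weight zero.\<close>
  have "lin_subst P (ext f) \<in> E"
    unfolding E_def
  proof safe
    fix m assume "m \<in> Poly_Mapping.keys (lin_subst P (ext f))"
    then show "weight w m = 0"
      using weight_0_if_algebraic[OF root finite_lessThan _ nz, of w m] c(3) A_W by (auto simp: W_def E_def)
  qed
  then show False
    using f(2) by (simp add: W_def)
qed

text \<open>If the relations of degree at most \<open>d\<close> span the plane, both sides hold;
  otherwise both fail, since equality would give dimension one.\<close>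

theorem finite_dimension_iff_eq:
  "ring.finite_dimension ring_of_type_algebra (adjoin (poly_invariants_le G \<rho> d)) (rat_invariants G \<rho>) \<longleftrightarrow>
    adjoin (poly_invariants_le G \<rho> d) = rat_invariants G \<rho>"
proof (cases "\<exists>p q r s. relation p q \<and> 0 \<le> p \<and> 0 \<le> q \<and> p + q \<le> int d \<and>
    relation r s \<and> 0 \<le> r \<and> 0 \<le> s \<and> r + s \<le> int d \<and> p * s \<noteq> q * r")
  case True
  then obtain p q r s where rank: "relation p q" "0 \<le> p" "0 \<le> q" "p + q \<le> int d"
    "relation r s" "0 \<le> r" "0 \<le> s" "r + s \<le> int d" "p * s \<noteq> q * r"
    by blast
  have "rat_invariants G \<rho> \<subseteq> adjoin (poly_invariants_le G \<rho> d)"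
  proof
    fix x assume "x \<in> rat_invariants G \<rho>"
    then obtain a b where "a \<in> poly_invariants G \<rho>" "b \<in> poly_invariants G \<rho>" "x = to_fract a / to_fract b"
      using rat_invariants_subset[OF group fin hom] by metis
    then show "x \<in> adjoin (poly_invariants_le G \<rho> d)"
      using invariant_in_adjoin[OF rank] by (simp add: adjoin_divide)
  qed
  then have "adjoin (poly_invariants_le G \<rho> d) = rat_invariants G \<rho>"
    using adjoin_invariants_subset[OF group hom] by blast
  then show ?thesis
    using finite_dimension_refl[OF subfield_adjoin] by metis
next
  case False
  have "\<exists>s t. (s \<noteq> 0 \<or> t \<noteq> 0) \<and>
    (\<forall>p q. relation p q \<longrightarrow> 0 \<le> p \<longrightarrow> 0 \<le> q \<longrightarrow> p + q \<le> int d \<longrightarrow> s * p + t * q = 0)"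
  proof (cases "\<exists>p q. relation p q \<and> 0 \<le> p \<and> 0 \<le> q \<and> p + q \<le> int d \<and> (p \<noteq> 0 \<or> q \<noteq> 0)")
    case True
    then obtain p q where pq: "relation p q" "0 \<le> p" "0 \<le> q" "p + q \<le> int d" "p \<noteq> 0 \<or> q \<noteq> 0"
      by blast
    \<comment> \<open>The points lie on the line through \<open>(p, q)\<close>, with normal vector
      \<open>(q, - p)\<close>; mixed signs are the reason for integer weights.\<close>
    have "q * r + (- p) * s = 0" if "relation r s" "0 \<le> r" "0 \<le> s" "r + s \<le> int d" for r s
      using False pq that by auto
    with pq(5) show ?thesis
      by (intro exI[of _ q] exI[of _ "- p"]) auto
  next
    case False
    \<comment> \<open>The origin is the only point left, so any nonzero functional would
      serve.\<close>
    then have "1 * p + 0 * q = 0" if "relation p q" "0 \<le> p" "0 \<le> q" "p + q \<le> int d" for p q :: int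
      using that by auto
    then show ?thesis
      by (intro exI[of _ 1] exI[of _ 0]) auto
  qed
  then have "\<not> ring.finite_dimension ring_of_type_algebra (adjoin (poly_invariants_le G \<rho> d)) (rat_invariants G \<rho>)"
    using infinite_dimension_if_deficient by blast
  then show ?thesis
    using finite_dimension_refl[OF subfield_adjoin, of "poly_invariants_le G \<rho> d"] by auto
qed

lemma gamma_field_eq_beta_field: "gamma_field G \<rho> = beta_field G \<rho>"
  by (simp add: gamma_field_def beta_field_def finite_dimension_iff_eq)

end

section \<open>Reduction of the theorem to the diagonal form\<close>

lemma occurring_characters_iff:
  fixes \<rho> :: "'g \<Rightarrow> ('k::field, 'n::finite) sqmat" and \<phi> :: "'k \<Rightarrow> 'e::field"
  shows "\<psi> \<in> occurring_characters G \<phi> \<rho> \<longleftrightarrow>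
    (\<forall>g\<in>carrier G. \<psi> g \<noteq> 0) \<and> (\<forall>g\<in>carrier G. \<forall>h\<in>carrier G. \<psi> (g \<otimes>\<^bsub>G\<^esub> h) = \<psi> g * \<psi> h) \<and>
    \<psi> \<in> extensional (carrier G) \<and>
    (\<exists>v :: 'e ^ 'n. v \<noteq> 0 \<and> (\<forall>g\<in>carrier G. (\<chi> i j. \<phi> (\<rho> g $ i $ j)) *v v = \<psi> g *s v))"
proof -
  interpret F: Ring.field "ring_of_type_algebra :: 'e ring"
    by (rule field_from_type_algebra)
  show ?thesis
    by (auto simp: occurring_characters_def hom_def units_of_def F.field_Units)
qed

theorem proposition4p1:
  fixes G :: "('g, 'b) monoid_scheme"
    and \<rho> :: "'g \<Rightarrow> ('k::field, 'n::{finite,linorder}) sqmat"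
    and \<phi> :: "'k \<Rightarrow> 'e::field"
  assumes "comm_group G" and "finite (carrier G)"
    and "\<not> CHAR('k) dvd order G"
    and "faithful_rep G \<rho>"
    and "\<phi> \<in> ring_hom ring_of_type_algebra ring_of_type_algebra"
    and "card {z :: 'e. z ^ order G = 1} = order G"
    and "card (occurring_characters G \<phi> \<rho> - {\<lambda>g\<in>carrier G. 1}) = 2"
  shows "gamma_field G \<rho> = beta_field G \<rho>"
proof -
  interpret G: comm_group G by fact
  interpret field_embedding \<phi>
    using ring_hom_add[OF assms(5)] ring_hom_mult[OF assms(5)] ring_hom_one[OF assms(5)]
    by unfold_locales simp_all
  let ?N = "order G"
  let ?M = "\<lambda>g. extmat (\<rho> g)"
  have \<rho>: "\<rho> \<in> hom G GL"
    using assms(4) by (simp add: faithful_rep_def)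
  have "of_nat ?N \<noteq> (0 :: 'k)"
    using assms(3) by (simp add: of_nat_eq_0_iff_char_dvd)
  then have N: "of_nat ?N \<noteq> (0 :: 'e)"
    by (metis of_nat eq_0_iff)
  have M_mult: "?M (g \<otimes>\<^bsub>G\<^esub> h) = ?M g ** ?M h" if "g \<in> carrier G" "h \<in> carrier G" for g h
    using that by (simp add: hom_GL[OF \<rho>] extmat_mult)
  have M_one: "?M \<one>\<^bsub>G\<^esub> = mat 1"
    by (simp add: hom_GL_one[OF G.is_group \<rho>] extmat_mat_1)
  have "((*v) (?M g) ^^ k) v = ?M (g [^]\<^bsub>G\<^esub> k) *v v" if "g \<in> carrier G" for g v and k :: nat
  proof (induction k)
    case (Suc k)
    have "?M (g [^]\<^bsub>G\<^esub> Suc k) = ?M g ** ?M (g [^]\<^bsub>G\<^esub> k)"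
      using that by (simp only: G.nat_pow_Suc2 M_mult G.nat_pow_closed)
    then show ?case
      by (simp add: Suc matrix_vector_mul_assoc)
  qed (simp add: M_one)
  then have M_pow: "((*v) (?M g) ^^ ?N) v = v" if "g \<in> carrier G" for g v
    using that by (simp add: G.pow_order_eq_1 M_one)
  have "?M g ** ?M h = ?M h ** ?M g" if "g \<in> carrier G" "h \<in> carrier G" for g h
    using that M_mult by (metis G.m_comm)
  from span_simultaneous_eigenvectors[OF assms(2,6) N M_pow this]
  have "vec.span {v. \<forall>g\<in>carrier G. \<exists>c. ?M g *v v = c *s v} = UNIV"
    by simp
  then obtain P :: "('e, 'n) sqmat" and c where P: "invertible P" and col: "\<And>i. column i P \<noteq> 0"
    and eig: "\<And>g i. g \<in> carrier G \<Longrightarrow> ?M g *v column i P = c g i *s column i P"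
    by (rule simultaneous_diagonalization) (rule that)
  obtain P' where P': "P ** P' = mat 1" "P' ** P = mat 1"
    using P by (auto simp: invertible_def)
  have c_mult: "c (g \<otimes>\<^bsub>G\<^esub> h) i = c g i * c h i" if gh: "g \<in> carrier G" "h \<in> carrier G" for g h i
  proof -
    have "c (g \<otimes>\<^bsub>G\<^esub> h) i *s column i P = ?M g *v (?M h *v column i P)"
      using gh by (simp add: eig[symmetric] M_mult matrix_vector_mul_assoc)
    also have "\<dots> = (c g i * c h i) *s column i P"
      using gh by (simp add: eig vec.linear_scale[OF matrix_vector_mul_linear_gen] mult.commute)
    finally show ?thesis
      using col by simp
  qed
  have c_one: "c \<one>\<^bsub>G\<^esub> i = 1" for i
    using eig[of "\<one>\<^bsub>G\<^esub>" i] col[of i] by (metis G.one_closed M_one matrix_vector_mul_lid vec.scale_one vec.scale_right_imp_eq)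
  have c_nz: "c g i \<noteq> 0" if "g \<in> carrier G" for g i
    using c_mult[of g "inv\<^bsub>G\<^esub> g" i] that by (auto simp: c_one)
  have "c (g [^]\<^bsub>G\<^esub> k) i = c g i ^ k" if "g \<in> carrier G" for g i and k :: nat
    by (induction k) (use that in \<open>simp_all add: c_one c_mult mult.commute\<close>)
  then have c_root: "c g i ^ ?N = 1" if "g \<in> carrier G" for g i
    using that by (metis G.pow_order_eq_1 c_one)
  \<comment> \<open>Restriction to the carrier makes the eigenvalue functions extensional, so that
    they can be compared with occurring characters.\<close>
  define ch where "ch = (\<lambda>i. \<lambda>g\<in>carrier G. c g i)"
  have ch_occ: "ch i \<in> occurring_characters G \<phi> \<rho>" for i
    unfolding occurring_characters_iff
    using col[of i] by (auto simp: ch_def c_mult c_nz eig[unfolded extmat_def] intro!: exI[of _ "column i P"])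
  \<comment> \<open>An eigenvector is expanded in the columns of \<open>P\<close>. At any index with
    nonzero coefficient the eigenvalue must agree with \<open>\<psi>\<close>, and this index is
    chosen independently of the group element.\<close>
  have occ_ch: "\<exists>i. ch i = \<psi>" if \<psi>: "\<psi> \<in> occurring_characters G \<phi> \<rho>" for \<psi>
  proof -
    obtain v where v: "v \<noteq> 0" and ev: "\<And>g. g \<in> carrier G \<Longrightarrow> ?M g *v v = \<psi> g *s v"
      and ext: "\<psi> \<in> extensional (carrier G)"
      using \<psi> unfolding occurring_characters_iff extmat_def by blast
    let ?x = "P' *v v"
    have Px: "P *v ?x = v"
      by (simp add: matrix_vector_mul_assoc P')
    then have "?x \<noteq> 0" using v by auto
    then obtain i where i: "?x $ i \<noteq> 0"
      by (auto simp: vec_eq_iff)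
    have "c g i = \<psi> g" if g: "g \<in> carrier G" for g
    proof -
      let ?D = "\<chi> i j. if i = j then c g i else 0"
      have "?D *v ?x = P' *v ((P ** ?D) *v ?x)"
        by (simp add: matrix_vector_mul_assoc matrix_mul_assoc P')
      also have "(P ** ?D) *v ?x = ?M g *v v"
        by (simp add: matrix_mult_eq_diagonal[OF eig[OF g], symmetric] matrix_vector_mul_assoc[symmetric] Px)
      also have "P' *v (?M g *v v) = \<psi> g *s ?x"
        by (simp add: ev[OF g] vec.linear_scale[OF matrix_vector_mul_linear_gen])
      finally have "(?D *v ?x) $ i = \<psi> g * ?x $ i"
        by simp
      moreover have "(?D *v ?x) $ i = c g i * ?x $ i"
        by (simp add: matrix_vector_mult_def if_distrib if_distribR cong: if_cong)
      ultimately show ?thesis using i by simp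
    qed
    then show ?thesis
      using ext by (intro exI[of _ i]) (auto simp: ch_def intro!: extensionalityI[of _ "carrier G"])
  qed
  obtain \<chi>\<^sub>1 \<chi>\<^sub>2 where two: "occurring_characters G \<phi> \<rho> - {\<lambda>g\<in>carrier G. 1} = {\<chi>\<^sub>1, \<chi>\<^sub>2}" "\<chi>\<^sub>1 \<noteq> \<chi>\<^sub>2"
    using assms(7) by (auto simp: card_2_iff)
  define I where "I = {i. ch i = \<chi>\<^sub>1}"
  define J where "J = {i. ch i = \<chi>\<^sub>2}"
  have occ: "\<chi>\<^sub>1 \<in> occurring_characters G \<phi> \<rho>" "\<chi>\<^sub>2 \<in> occurring_characters G \<phi> \<rho>"
    using two(1) by blast+
  then obtain i j where ij: "ch i = \<chi>\<^sub>1" "ch j = \<chi>\<^sub>2"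
    using occ_ch by blast
  \<comment> \<open>A column whose character is neither \<open>\<chi>\<^sub>1\<close> nor
    \<open>\<chi>\<^sub>2\<close> carries the trivial one, whence the value 1.\<close>
  have c_eq: "c g i = (if i \<in> I then \<chi>\<^sub>1 g else if i \<in> J then \<chi>\<^sub>2 g else 1)" if g: "g \<in> carrier G" for g i
  proof -
    have "ch i \<in> {\<lambda>g\<in>carrier G. 1, \<chi>\<^sub>1, \<chi>\<^sub>2}"
      using ch_occ[of i] two(1) by blast
    moreover have "c g i = ch i g"
      using g by (simp add: ch_def)
    ultimately show ?thesis
      using g by (auto simp: I_def J_def)
  qed
  have roots: "ch i g ^ ?N = 1" if "g \<in> carrier G" for g i
    using that by (simp add: ch_def c_root)
  interpret two_character_rep \<phi> G \<rho> P P' \<chi>\<^sub>1 \<chi>\<^sub>2 I J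
  proof
    fix g assume g: "g \<in> carrier G"
    show "?M g ** P = P ** (\<chi> i j. if i = j then if i \<in> I then \<chi>\<^sub>1 g else if i \<in> J then \<chi>\<^sub>2 g else 1 else 0)"
      using matrix_mult_eq_diagonal[OF eig[OF g]] unfolding c_eq[OF g] .
    show "\<chi>\<^sub>1 g ^ ?N = 1" "\<chi>\<^sub>2 g ^ ?N = 1"
      using roots[OF g] ij by metis+
  next
    show "I \<inter> J = {}" "I \<noteq> {}" "J \<noteq> {}"
      using ij two(2) by (auto simp: I_def J_def)
  qed (use assms(2) \<rho> P' in auto)
  show ?thesis
    by (rule gamma_field_eq_beta_field)
qed

end
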